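(* Let $\tau>\pi/2$ and let $\widetilde{C}\subset S^2$ be a spherical convex body of constant width $\tau$. Then for every $\varepsilon>0$ there exists a spherical convex body $\widetilde{C}_\varepsilon\subset S^2$ of constant width $\tau$, whose boundary consists only of arcs of circles of radius $\tau-\frac{\pi}{2}$ and great circle segments, such that $h(\widetilde{C},\widetilde{C}_\varepsilon)\le\varepsilon$, where $h$ is the Hausdorff distance.
   Context: $S^2$ is the unit sphere in $\mathbb{R}^3$ and $|\widetilde P\widetilde Q|=\arccos(\widetilde P\cdot\widetilde Q)$ is the spherical distance; $h$ is the Hausdorff distance with respect to it. For $\widetilde P\in S^2$ let $H(\widetilde P)=\{\widetilde Q\in S^2\mid\widetilde P\cdot\widetilde Q\ge0\}$ be the closed hemisphere centered at $\widetilde P$. A set $\widetilde X\subset S^2$ is hemispherical if $H(\widetilde P)\cap\widetilde X=\emptyset$ for some $\widetilde P\in S^2$. For $\widetilde P\ne-\widetilde Q$, the arc $\widetilde P\widetilde Q$ is the shorter great circle arc joining them. A hemispherical set is spherical convex if it contains the arc $\widetilde P\widetilde Q$ for any two of its points $\widetilde P,\widetilde Q$; a spherical convex body is a closed spherical convex set with an interior point. A hemisphere $H(\widetilde Q)$ supports $\widetilde C$ at $\widetilde P\in\partial\widetilde C$ (and is a supporting hemisphere of $\widetilde C$) if $\widetilde C\subset H(\widetilde Q)$ and $\widetilde P\in\widetilde C\cap\partial H(\widetilde Q)$. If $\widetilde P\ne\pm\widetilde Q$, the lune $H(\widetilde P)\cap H(\widetilde Q)$ has thickness $\Delta(H(\widetilde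 P)\cap H(\widetilde Q))=\pi-|\widetilde P\widetilde Q|$. For a supporting hemisphere $H(\widetilde P)$ of $\widetilde C$, the width is $\mathrm{width}_{H(\widetilde P)}(\widetilde C)=\min\{\Delta(H(\widetilde P)\cap H(\widetilde Q))\mid H(\widetilde Q)\text{ supports }\widetilde C\}$ (minimum over $\widetilde Q\neq\pm\widetilde P$). $\widetilde C$ is of constant width $\tau$ if $\mathrm{width}_{H(\widetilde P)}(\widetilde C)=\tau$ for all supporting hemispheres $H(\widetilde P)$. A circle of radius $\rho$ on $S^2$ is a set $\{\widetilde Q\in S^2\mid|\widetilde P\widetilde Q|=\rho\}$; "the boundary consists only of" certain arcs means that it is a finite union of such arcs. *)

theory Defs
  imports "HOL-Analysis.Analysis"
begin

type_synonym point = "real ^ 3"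

abbreviation S2 :: "point set" where
  "S2 \<equiv> sphere 0 1"

definition sdist :: "point \<Rightarrow> point \<Rightarrow> real" where
  "sdist P Q = arccos (P \<bullet> Q)"

text \<open>Interior and boundary are always taken relative to the sphere: as subsets of the
  ambient space, all sets considered here have empty interior.\<close>

abbreviation sphere_interior :: "point set \<Rightarrow> point set" where
  "sphere_interior X \<equiv> (top_of_set S2) interior_of X"

abbreviation sphere_boundary :: "point set \<Rightarrow> point set" where
  "sphere_boundary X \<equiv> (top_of_set S2) frontier_of X"

text \<open>Only meaningful for nonempty sets; boundedness is automatic on the sphere.\<close>

definition hausdorff_sdist :: "point set \<Rightarrow> point set \<Rightarrow> real" where
  "hausdorff_sdist X Y =
     max (SUP P\<in>X. INF Q\<in>Y. sdist P Q) (SUP Q\<in>Y. INF P\<in>X. sdist P Q)"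

definition hemisphere :: "point \<Rightarrow> point set" where
  "hemisphere P = {Q \<in> S2. P \<bullet> Q \<ge> 0}"

definition hemispherical :: "point set \<Rightarrow> bool" where
  "hemispherical X \<longleftrightarrow> X \<subseteq> S2 \<and> (\<exists>P\<in>S2. hemisphere P \<inter> X = {})"

text \<open>The shorter great circle arc joining \<open>P \<noteq> - Q\<close> is the radial projection to the sphere of
  the chord between them; \<^const>\<open>sgn\<close> normalizes a nonzero vector.\<close>

definition great_arc :: "point \<Rightarrow> point \<Rightarrow> point set" where
  "great_arc P Q = sgn ` closed_segment P Q"

text \<open>A hemispherical set contains no two antipodal points, so no case distinction is needed.\<close>

definition spherical_convex :: "point set \<Rightarrow> bool" where
  "spherical_convex X \<longleftrightarrow> hemispherical X \<and> (\<forall>P\<in>X. \<forall>Q\<in>X. great_arc P Q \<subseteq> X)"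

definition spherical_convex_body :: "point set \<Rightarrow> bool" where
  "spherical_convex_body X \<longleftrightarrow>
     closedin (top_of_set S2) X \<and> spherical_convex X \<and> sphere_interior X \<noteq> {}"

definition supports_at :: "point \<Rightarrow> point set \<Rightarrow> point \<Rightarrow> bool" where
  "supports_at Q X P \<longleftrightarrow>
     Q \<in> S2 \<and> P \<in> sphere_boundary X \<and>
     X \<subseteq> hemisphere Q \<and> P \<in> X \<inter> sphere_boundary (hemisphere Q)"

definition supporting :: "point \<Rightarrow> point set \<Rightarrow> bool" where
  "supporting Q X \<longleftrightarrow> (\<exists>P. supports_at Q X P)"

text \<open>The thickness of the lune \<open>hemisphere P \<inter> hemisphere Q\<close>, for \<open>P \<noteq> \<plusminus> Q\<close>.\<close>

definition lune_thickness :: "point \<Rightarrow> point \<Rightarrow> real" where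
  "lune_thickness P Q = pi - sdist P Q"

definition width :: "point \<Rightarrow> point set \<Rightarrow> real" where
  "width P X =
     (LEAST w. \<exists>Q. supporting Q X \<and> Q \<noteq> P \<and> Q \<noteq> - P \<and> w = lune_thickness P Q)"

definition constant_width :: "point set \<Rightarrow> real \<Rightarrow> bool" where
  "constant_width X \<tau> \<longleftrightarrow> (\<forall>P. supporting P X \<longrightarrow> width P X = \<tau>)"

definition spherical_circle :: "point \<Rightarrow> real \<Rightarrow> point set" where
  "spherical_circle P \<rho> = {Q \<in> S2. sdist P Q = \<rho>}"

text \<open>The arcs are nondegenerate (more than one point) and not the full circle.\<close>

definition circle_arc :: "real \<Rightarrow> point set \<Rightarrow> bool" where
  "circle_arc \<rho> A \<longleftrightarrow>
     (\<exists>P\<in>S2. \<exists>g. arc g \<and> path_image g = A \<and> A \<subseteq> spherical_circle P \<rho>)"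

definition great_circle_segment :: "point set \<Rightarrow> bool" where
  "great_circle_segment A \<longleftrightarrow>
     (\<exists>P\<in>S2. \<exists>Q\<in>S2. P \<noteq> Q \<and> P \<noteq> - Q \<and> A = great_arc P Q)"

definition boundary_consists_of_arcs :: "real \<Rightarrow> point set \<Rightarrow> bool" where
  "boundary_consists_of_arcs \<rho> X \<longleftrightarrow>
     (\<exists>\<A>. finite \<A> \<and> (\<forall>A\<in>\<A>. circle_arc \<rho> A \<or> great_circle_segment A) \<and>
          sphere_boundary X = \<Union>\<A>)"

end

theory Submission
  imports Defs
begin

text \<open>Put \<open>c = - cos \<tau> > 0\<close>. By polarity, the supporting hemispheres of \<open>C\<close> are centred at the boundary
  points of the polar body \<open>K\<close>, so \<open>C\<close> has constant width \<open>\<tau>\<close> iff every boundary point of \<open>K\<close> has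
  largest distance \<open>\<pi> - \<tau> = arccos c < \<pi> / 2\<close> to \<open>K\<close>. Such a \<open>K\<close> is complete: it is the intersection
  of the discs of radius \<open>arccos c\<close> about its points. A sufficiently dense finite subset \<open>X\<close> of \<open>K\<close> that
  contains a diametral pair \<open>a, b\<close> is completed to a Reuleaux polygon by adding to it those
  vertices of the intersection of the discs about \<open>X\<close> that lie on one fixed side of \<open>ab\<close>. The polar of
  a Reuleaux polygon is bounded by arcs of radius \<open>\<tau> - \<pi> / 2\<close> (dual to its edges) and by great circle
  segments (dual to its vertices), and it is close to \<open>C\<close> by completeness of both bodies.\<close>

subsection \<open>Geometry of the sphere\<close>

text \<open>Writing "distance at most \<open>arccos c\<close>" as
  \<open>c \<le> x \<bullet> y\<close> turns discs into half-spaces. Convexity is then linear up to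
  normalisation by \<open>sgn\<close>, and an extremal point \<open>P\<close> is tested by moving it
  to \<open>sgn (P + t *\<^sub>R v)\<close> for small \<open>t > 0\<close>. The obstacle is the
  completion. Adding all vertices of the intersection of the discs can fail, because vertices on
  opposite sides of \<open>ab\<close> may be farther apart than \<open>arccos c\<close>. Over a
  diametral chord, however, each half of the intersection has diameter at most
  \<open>arccos c\<close>. So the vertices on one side are compatible, and they suffice: a point of
  the intersection that is within \<open>arccos c\<close> of them is so for the whole half on that
  side. This is why \<open>X\<close> must contain a diametral pair. The completion and
  \<open>K\<close> need not contain one another, so their closeness cannot come from inclusion. It
  comes from the common net \<open>X\<close>, which forces points of the completion to satisfy the
  constraints of \<open>K\<close> up to a small error.\<close>

lemma S2_norm: "x \<in> S2 \<longleftrightarrow> norm x = 1"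
  by simp

lemma S2_inner_self: "x \<in> S2 \<Longrightarrow> x \<bullet> x = 1"
  by (simp add: dot_square_norm)

lemma S2_I: "x \<bullet> x = 1 \<Longrightarrow> x \<in> S2"
  by (simp add: norm_eq_sqrt_inner)

lemma sgn_in_S2: "v \<noteq> 0 \<Longrightarrow> sgn v \<in> S2"
  for v :: point
  by (simp add: norm_sgn)

lemma sgn_S2: "x \<in> S2 \<Longrightarrow> sgn x = x"
  by (simp add: sgn_div_norm)

lemma norm_scaleR_sgn: "norm v *\<^sub>R sgn v = v"
  for v :: point
  by (cases "v = 0") (simp_all add: sgn_div_norm)

lemma inner_sgn_right: "x \<bullet> sgn v = (x \<bullet> v) / norm v"
  for v :: point
  by (simp add: sgn_div_norm divide_inverse mult.commute)

lemma S2_inner_le_1: "x \<in> S2 \<Longrightarrow> y \<in> S2 \<Longrightarrow> x \<bullet> y \<le> 1"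
  using norm_cauchy_schwarz[of x y] by simp

lemma S2_abs_inner_le_1: "x \<in> S2 \<Longrightarrow> y \<in> S2 \<Longrightarrow> \<bar>x \<bullet> y\<bar> \<le> 1"
  using Cauchy_Schwarz_ineq2[of x y] by simp

lemma S2_inner_eq_1: "x \<in> S2 \<Longrightarrow> y \<in> S2 \<Longrightarrow> x \<bullet> y = 1 \<longleftrightarrow> x = y"
  using norm_cauchy_schwarz_eq[of x y] by auto

lemma S2_inner_less_1: "x \<in> S2 \<Longrightarrow> y \<in> S2 \<Longrightarrow> x \<noteq> y \<Longrightarrow> x \<bullet> y < 1"
  using S2_inner_le_1[of x y] S2_inner_eq_1[of x y] by linarith

lemma S2_inner_gt_m1:
  assumes "x \<in> S2" "y \<in> S2" "x \<noteq> - y"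
  shows "x \<bullet> y > -1"
  using S2_inner_less_1[of x "- y"] assms by simp

lemma S2_norm_diff_sq: "x \<in> S2 \<Longrightarrow> y \<in> S2 \<Longrightarrow> (norm (x - y))\<^sup>2 = 2 - 2 * (x \<bullet> y)"
  by (simp add: power2_norm_eq_inner inner_diff_left inner_diff_right inner_commute S2_inner_self)

section \<open>Small displacements of a point of the sphere\<close>

lemma sgn_perturb_tendsto:
  fixes P v :: point
  assumes "P \<in> S2"
  shows "((\<lambda>t. sgn (P + t *\<^sub>R v)) \<longlongrightarrow> P) (at_right 0)"
proof -
  have "((\<lambda>t. P + t *\<^sub>R v) \<longlongrightarrow> P + 0 *\<^sub>R v) (at_right 0)"
    by (intro tendsto_intros)
  moreover have "P \<noteq> 0" using assms by auto
  ultimately have "((\<lambda>t. sgn (P + t *\<^sub>R v)) \<longlongrightarrow> sgn P) (at_right 0)"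
    by (intro tendsto_sgn) auto
  then show ?thesis using sgn_S2[OF assms] by simp
qed

lemma inner_sgn_perturb_tendsto:
  fixes P v :: point
  assumes "P \<in> S2"
  shows "((\<lambda>t. x \<bullet> sgn (P + t *\<^sub>R v)) \<longlongrightarrow> x \<bullet> P) (at_right 0)"
  by (intro tendsto_intros sgn_perturb_tendsto assms)

lemma eventually_perturb_nonzero:
  fixes P v :: point
  assumes "P \<in> S2"
  shows "\<forall>\<^sub>F t in at_right 0. P + t *\<^sub>R v \<noteq> 0"
proof -
  have "((\<lambda>t. P + t *\<^sub>R v) \<longlongrightarrow> P + 0 *\<^sub>R v) (at_right 0)"
    by (intro tendsto_intros)
  then have "\<forall>\<^sub>F t in at_right 0. P + t *\<^sub>R v \<in> - {0}"
    by (rule topological_tendstoD) (use assms in auto)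
  then show ?thesis by simp
qed

text \<open>Subtracting \<open>t *\<^sub>R P\<close> lowers the inner product with \<open>P\<close>
  by \<open>t\<close>. Normalisation cannot make up for it: the norm differs from 1 by at most
  \<open>t\<close>, and this difference enters with the factor \<open>P \<bullet> Q\<close>, which
  is below 1 in absolute value.\<close>

lemma move_away_decreases_inner:
  fixes P Q :: point
  assumes "P \<in> S2" "Q \<in> S2" "\<bar>P \<bullet> Q\<bar> < 1" "t > 0"
  shows "P \<bullet> sgn (Q - t *\<^sub>R P) < P \<bullet> Q"
proof (rule ccontr)
  define k where "k = norm (Q - t *\<^sub>R P)"
  assume "\<not> ?thesis"
  then have ge: "P \<bullet> Q \<le> P \<bullet> sgn (Q - t *\<^sub>R P)" by simp
  have "Q - t *\<^sub>R P = k *\<^sub>R sgn (Q - t *\<^sub>R P)"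
    by (simp add: k_def norm_scaleR_sgn)
  then have "P \<bullet> (Q - t *\<^sub>R P) = k * (P \<bullet> sgn (Q - t *\<^sub>R P))"
    by (metis inner_scaleR_right)
  moreover have "P \<bullet> (Q - t *\<^sub>R P) = P \<bullet> Q - t"
    using assms by (simp add: inner_diff_right S2_inner_self)
  moreover have "k \<ge> 0" by (simp add: k_def)
  ultimately have "P \<bullet> Q - t \<ge> k * (P \<bullet> Q)"
    using ge by (metis mult_left_mono)
  then have "t \<le> (P \<bullet> Q) * (1 - k)" by (simp add: algebra_simps)
  also have "\<dots> \<le> \<bar>P \<bullet> Q\<bar> * \<bar>1 - k\<bar>" by (metis abs_ge_self abs_mult)
  also have "\<bar>1 - k\<bar> \<le> t"
    using norm_triangle_ineq3[of Q "Q - t *\<^sub>R P"] assms by (simp add: k_def)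
  then have "\<bar>P \<bullet> Q\<bar> * \<bar>1 - k\<bar> \<le> \<bar>P \<bullet> Q\<bar> * t" by (simp add: mult_left_mono)
  also have "\<dots> < 1 * t" using assms by (intro mult_strict_right_mono) auto
  finally show False by simp
qed

lemma ex_eventually_at_right_0:
  fixes R :: "real \<Rightarrow> bool"
  assumes "\<forall>\<^sub>F t in at_right 0. R t"
  obtains t where "t > 0" "R t"
proof -
  have "\<forall>\<^sub>F t in at_right (0::real). R t \<and> t > 0"
    using assms eventually_at_right_less by (rule eventually_conj)
  then obtain t where "R t \<and> t > 0"
    using eventually_happens trivial_limit_at_right_real by blast
  then show thesis using that by blast
qed

text \<open>By compactness the strict inequality has a positive gap, and
  \<open>x \<bullet> Q\<close> is 1-Lipschitz in \<open>Q\<close> because \<open>x\<close> is a unit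
  vector; the gap itself serves as the radius. \<open>P\<close> and \<open>Q\<close> range over all
  vectors, since the lemma is also applied along a chord inside the ball.\<close>

lemma strict_bound_near:
  fixes X :: "point set"
  assumes "compact X" "X \<subseteq> S2" and less: "\<And>x. x \<in> X \<Longrightarrow> c < x \<bullet> P"
  obtains r where "r > 0" "\<And>Q x. dist Q P < r \<Longrightarrow> x \<in> X \<Longrightarrow> c < x \<bullet> Q"
proof (cases "X = {}")
  case True
  then show ?thesis using that[of 1] by simp
next
  case False
  have "continuous_on X (\<lambda>x. x \<bullet> P)" by (intro continuous_intros)
  then obtain x0 where x0: "x0 \<in> X" "\<And>x. x \<in> X \<Longrightarrow> x0 \<bullet> P \<le> x \<bullet> P"
    using continuous_attains_inf[OF assms(1) False] by blast
  have "c < x \<bullet> Q" if d: "dist Q P < x0 \<bullet> P - c" and x: "x \<in> X" for Q x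
  proof -
    have "x \<bullet> P - x \<bullet> Q = x \<bullet> (P - Q)" by (simp add: inner_diff_right)
    also have "\<dots> \<le> norm x * norm (P - Q)" by (rule norm_cauchy_schwarz)
    also have "\<dots> < x0 \<bullet> P - c"
      using d x assms(2) by (auto simp: dist_norm norm_minus_commute)
    finally show "c < x \<bullet> Q" using x0(2)[OF x] by linarith
  qed
  then show ?thesis using that[of "x0 \<bullet> P - c"] less[OF x0(1)] by simp
qed

lemma eventually_perturb_bound:
  fixes X :: "point set"
  assumes "compact X" "X \<subseteq> S2" "P \<in> S2" and less: "\<And>x. x \<in> X \<Longrightarrow> c < x \<bullet> P"
  shows "\<forall>\<^sub>F t in at_right 0. \<forall>x\<in>X. c < x \<bullet> sgn (P + t *\<^sub>R v)"
proof -
  obtain r where r: "r > 0" "\<And>Q x. dist Q P < r \<Longrightarrow> x \<in> X \<Longrightarrow> c < x \<bullet> Q"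
    using strict_bound_near[OF assms(1,2) less] by blast
  show ?thesis
    using tendstoD[OF sgn_perturb_tendsto[OF assms(3)] r(1)] by (rule eventually_mono) (use r(2) in blast)
qed

text \<open>The intersection of the discs of radius \<open>arccos c\<close> about the points of \<open>X\<close>; for \<open>c = 0\<close> it is
  the polar set of \<open>X\<close>.\<close>

definition caps :: "real \<Rightarrow> point set \<Rightarrow> point set" where
  "caps c X = {y \<in> S2. \<forall>x\<in>X. c \<le> x \<bullet> y}"

lemma caps_subset_S2: "caps c X \<subseteq> S2"
  by (auto simp: caps_def)

lemma capsD: "y \<in> caps c X \<Longrightarrow> x \<in> X \<Longrightarrow> c \<le> x \<bullet> y"
  by (auto simp: caps_def)

lemma caps_in_S2: "y \<in> caps c X \<Longrightarrow> y \<in> S2"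
  by (auto simp: caps_def)

lemma caps_antimono: "X \<subseteq> Y \<Longrightarrow> caps c Y \<subseteq> caps c X"
  by (auto simp: caps_def)

lemma closed_caps: "closed (caps c X)"
proof -
  have "caps c X = S2 \<inter> (\<Inter>x\<in>X. {y. c \<le> x \<bullet> y})" by (auto simp: caps_def)
  moreover have "closed \<dots>"
    by (intro closed_Int closed_INT ballI closed_Collect_le continuous_intros) auto
  ultimately show ?thesis by simp
qed

lemma compact_caps: "compact (caps c X)"
  using closed_caps caps_subset_S2 by (metis compact_Int_closed compact_sphere inf.absorb_iff2)

text \<open>Discs of radius at most pi / 2 are convex: the norm of the combination is at most
  \<open>\<alpha> + \<beta>\<close>, so for \<open>0 \<le> c\<close> normalising can only improve on
  the bound \<open>c * (\<alpha> + \<beta>)\<close>.\<close>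

lemma caps_conic_combination:
  assumes "0 \<le> c" "p \<in> S2" "q \<in> S2" "\<And>x. x \<in> X \<Longrightarrow> c \<le> x \<bullet> p" "\<And>x. x \<in> X \<Longrightarrow> c \<le> x \<bullet> q"
    "0 \<le> \<alpha>" "0 \<le> \<beta>" "\<alpha> *\<^sub>R p + \<beta> *\<^sub>R q \<noteq> 0"
  shows "sgn (\<alpha> *\<^sub>R p + \<beta> *\<^sub>R q) \<in> caps c X"
  unfolding caps_def
proof (intro CollectI conjI ballI)
  show "sgn (\<alpha> *\<^sub>R p + \<beta> *\<^sub>R q) \<in> S2" using assms(8) by (rule sgn_in_S2)
  fix x assume x: "x \<in> X"
  have "norm (\<alpha> *\<^sub>R p + \<beta> *\<^sub>R q) \<le> \<alpha> + \<beta>"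
    using norm_triangle_ineq[of "\<alpha> *\<^sub>R p" "\<beta> *\<^sub>R q"] assms by simp
  then have "c * norm (\<alpha> *\<^sub>R p + \<beta> *\<^sub>R q) \<le> c * (\<alpha> + \<beta>)"
    using assms(1) by (rule mult_left_mono)
  also have "\<dots> \<le> \<alpha> * (x \<bullet> p) + \<beta> * (x \<bullet> q)"
    using mult_left_mono[OF assms(4)[OF x] assms(6)] mult_left_mono[OF assms(5)[OF x] assms(7)]
    by (simp add: algebra_simps)
  also have "\<dots> = x \<bullet> (\<alpha> *\<^sub>R p + \<beta> *\<^sub>R q)" by (simp add: inner_add_right)
  finally show "c \<le> x \<bullet> sgn (\<alpha> *\<^sub>R p + \<beta> *\<^sub>R q)"
    using assms(8) by (simp add: inner_sgn_right pos_le_divide_eq)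
qed

section \<open>Great arcs as cones, and closed convex subsets of a great circle\<close>

lemma great_arc_conic:
  fixes P Q :: point
  assumes "0 \<le> \<alpha>" "0 \<le> \<beta>" "\<alpha> *\<^sub>R P + \<beta> *\<^sub>R Q \<noteq> 0"
  shows "sgn (\<alpha> *\<^sub>R P + \<beta> *\<^sub>R Q) \<in> great_arc P Q"
proof -
  have pos: "\<alpha> + \<beta> > 0"
    using assms by (metis add_cancel_right_right add_nonneg_eq_0_iff less_eq_real_def add_nonneg_nonneg scale_zero_left)
  define r where "r = \<beta> / (\<alpha> + \<beta>)"
  have r: "0 \<le> r" "r \<le> 1" using assms pos by (auto simp: r_def)
  have "1 - r = \<alpha> / (\<alpha> + \<beta>)" using pos by (simp add: r_def field_simps)
  then have "(1 - r) *\<^sub>R P + r *\<^sub>R Q = inverse (\<alpha> + \<beta>) *\<^sub>R (\<alpha> *\<^sub>R P + \<beta> *\<^sub>R Q)"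
    by (simp add: r_def scaleR_add_right divide_inverse mult.commute)
  then have "sgn ((1 - r) *\<^sub>R P + r *\<^sub>R Q) = sgn (\<alpha> *\<^sub>R P + \<beta> *\<^sub>R Q)"
    using pos by (simp add: sgn_scaleR)
  moreover have "(1 - r) *\<^sub>R P + r *\<^sub>R Q \<in> closed_segment P Q"
    using r by (auto simp: closed_segment_def)
  ultimately show ?thesis unfolding great_arc_def by (metis image_eqI)
qed

lemma great_arcE:
  assumes "y \<in> great_arc P Q"
  obtains r where "0 \<le> r" "r \<le> 1" "y = sgn ((1 - r) *\<^sub>R P + r *\<^sub>R Q)"
  using assms by (auto simp: great_arc_def closed_segment_def)

text \<open>The vector \<open>e\<close> keeps the chord from \<open>p\<close> to \<open>q\<close>
  away from 0, where \<open>sgn\<close> would leave the sphere.\<close>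

lemma caps_great_arc:
  assumes "0 \<le> c" "p \<in> caps c X" "q \<in> caps c X" "e \<bullet> p > 0" "e \<bullet> q > 0"
  shows "great_arc p q \<subseteq> caps c X"
proof
  fix y assume "y \<in> great_arc p q"
  then obtain r where r: "0 \<le> r" "r \<le> 1" "y = sgn ((1 - r) *\<^sub>R p + r *\<^sub>R q)" by (rule great_arcE)
  have "e \<bullet> ((1 - r) *\<^sub>R p + r *\<^sub>R q) > 0"
  proof (cases "r = 0")
    case False
    then show ?thesis using r assms 
      by (auto simp: inner_add_right intro!: add_nonneg_pos)
  qed (use assms in simp)
  then have "(1 - r) *\<^sub>R p + r *\<^sub>R q \<noteq> 0" by auto
  then show "y \<in> caps c X"
    unfolding r(3) using assms r by (intro caps_conic_combination) (auto simp: caps_def)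
qed

text \<open>By the double cross product identity, a vector orthogonal to \<open>n\<close> and
  \<open>e\<close> is parallel to \<open>cross3 n e\<close>, to which \<open>d\<close> is orthogonal
  as well.\<close>

lemma orthogonal_basis_zero:
  assumes "n \<bullet> d = 0" "e \<bullet> d = 0" "cross3 n e \<bullet> d = 0" "cross3 n e \<noteq> 0"
  shows "d = 0"
proof -
  have "cross3 (cross3 n e) d = (n \<bullet> d) *\<^sub>R e - (e \<bullet> d) *\<^sub>R n"
    using cross_skew[of "cross3 n e" d] Lagrange[of d n e] by (simp add: inner_commute)
  then have "cross3 (cross3 n e) d = 0" using assms by simp
  then show ?thesis using assms norm_and_cross_eq_0 by blast
qed

lemma cross3_nonzero:
  assumes "n \<bullet> u = 0" "e \<bullet> u \<noteq> 0" "n \<noteq> 0"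
  shows "cross3 n e \<noteq> 0"
proof
  assume z: "cross3 n e = 0"
  have "cross3 n (cross3 n e) = (n \<bullet> e) *\<^sub>R n - (n \<bullet> n) *\<^sub>R e" by (rule Lagrange)
  then have "(n \<bullet> n) *\<^sub>R e = (n \<bullet> e) *\<^sub>R n" using z by simp
  then have "(n \<bullet> n) * (e \<bullet> u) = (n \<bullet> e) * (n \<bullet> u)" by (metis inner_scaleR_left)
  then show False using assms by simp
qed

text \<open>Central projection to the line \<open>n \<bullet> x = 0\<close>,
  \<open>e \<bullet> x = 1\<close> turns great arcs into segments, so \<open>U\<close> becomes a
  compact interval; its ends give \<open>P\<close> and \<open>Q\<close>, which may coincide. The
  lemma serves both for the edges of a Reuleaux polygon and for the segments dual to its
  vertices.\<close>

lemma circle_convex_eq_great_arc: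
  fixes U :: "point set"
  assumes "closed U" "U \<noteq> {}" "U \<subseteq> S2" "n \<noteq> 0"
    and n: "\<And>u. u \<in> U \<Longrightarrow> n \<bullet> u = 0"
    and e: "\<And>u. u \<in> U \<Longrightarrow> e \<bullet> u > 0"
    and conv: "\<And>u v. u \<in> U \<Longrightarrow> v \<in> U \<Longrightarrow> great_arc u v \<subseteq> U"
  obtains P Q where "P \<in> U" "Q \<in> U" "U = great_arc P Q"
proof -
  define w where "w = cross3 n e"
  \<comment> \<open>The coordinate, in the direction \<open>w\<close>, of the central projection of
    \<open>u\<close>.\<close>
  define m where "m u = (w \<bullet> u) / (e \<bullet> u)" for u
  have w: "w \<noteq> 0" unfolding w_def
    using assms(2,4) n e cross3_nonzero by (metis ex_in_conv less_irrefl)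
  have "compact U" using assms(1,3) by (metis compact_Int_closed compact_sphere inf.absorb_iff2)
  moreover have "continuous_on U m" unfolding m_def
    by (intro continuous_intros) (use e in force)
  ultimately obtain P Q where PQ: "P \<in> U" "Q \<in> U" "\<And>u. u \<in> U \<Longrightarrow> m P \<le> m u" "\<And>u. u \<in> U \<Longrightarrow> m u \<le> m Q"
    using continuous_attains_inf[of U m] continuous_attains_sup[of U m] assms(2) by blast
  have "u \<in> great_arc P Q" if u: "u \<in> U" for u
  proof -
    obtain r where r: "0 \<le> r" "r \<le> 1" "m u = (1 - r) * m P + r * m Q"
    proof (cases "m P = m Q")
      case True
      then have "m u = m P" using PQ(3,4)[OF u] by simp
      then show ?thesis using that[of 0] by simp
    next
      case False
      then have "m Q - m P > 0" using PQ(3)[OF PQ(2)] by simp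
      define r where "r = (m u - m P) / (m Q - m P)"
      have "0 \<le> r" "r \<le> 1" "r * (m Q - m P) = m u - m P"
        using PQ(3,4)[OF u] \<open>m Q - m P > 0\<close> by (auto simp: r_def)
      then show ?thesis using that[of r] by (simp add: algebra_simps)
    qed
    define P' Q' where "P' = inverse (e \<bullet> P) *\<^sub>R P" and "Q' = inverse (e \<bullet> Q) *\<^sub>R Q"
    define d where "d = inverse (e \<bullet> u) *\<^sub>R u - ((1 - r) *\<^sub>R P' + r *\<^sub>R Q')"
    have eP: "e \<bullet> P > 0" "e \<bullet> Q > 0" "e \<bullet> u > 0" using e PQ u by auto
    have nP: "n \<bullet> P = 0" "n \<bullet> Q = 0" "n \<bullet> u = 0" using n PQ u by auto
    have "n \<bullet> d = 0" using nP by (simp add: d_def P'_def Q'_def inner_add_right inner_diff_right)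
    moreover have "e \<bullet> d = 0" using eP
      by (simp add: d_def P'_def Q'_def inner_add_right inner_diff_right mult.assoc)
    moreover have "w \<bullet> d = 0" using r(3)
      by (simp add: d_def P'_def Q'_def m_def inner_add_right inner_diff_right divide_inverse mult_ac)
    ultimately have "d = 0" using orthogonal_basis_zero w unfolding w_def by blast
    then have eq: "inverse (e \<bullet> u) *\<^sub>R u = ((1 - r) * inverse (e \<bullet> P)) *\<^sub>R P + (r * inverse (e \<bullet> Q)) *\<^sub>R Q"
      by (simp add: d_def P'_def Q'_def)
    have "sgn (inverse (e \<bullet> u) *\<^sub>R u) = u"
      using eP(3) u assms(3) sgn_S2 by (simp add: sgn_scaleR subset_iff)
    moreover have "inverse (e \<bullet> u) *\<^sub>R u \<noteq> 0" using eP(3) by auto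
    ultimately show ?thesis unfolding eq
      using great_arc_conic[of "(1 - r) * inverse (e \<bullet> P)" "r * inverse (e \<bullet> Q)" P Q] r eP
      by (metis diff_ge_0_iff_ge eq inverse_nonnegative_iff_nonnegative less_imp_le mult_nonneg_nonneg)
  qed
  then have "U = great_arc P Q" using conv PQ by blast
  then show ?thesis using that PQ by blast
qed

text \<open>A tangential displacement in both directions leaves a great arc at its endpoints.\<close>

lemma great_arc_endpoint_extremal:
  fixes P Q w :: point
  assumes "P \<in> S2" "P \<bullet> w = 0" "w \<noteq> 0" "t > 0"
    and "sgn (P + t *\<^sub>R w) \<in> great_arc P Q" "sgn (P - t *\<^sub>R w) \<in> great_arc P Q"
  shows False
proof -
  have wP: "w \<bullet> P = 0" using assms by (simp add: inner_commute)
  have ww: "w \<bullet> w > 0" using assms by simp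
  have nz: "norm (P + t *\<^sub>R w) > 0" "norm (P - t *\<^sub>R w) > 0"
  proof -
    have "w \<bullet> (P + t *\<^sub>R w) \<noteq> 0" "w \<bullet> (P - t *\<^sub>R w) \<noteq> 0"
      using wP ww assms by (auto simp: inner_add_right inner_diff_right)
    then show "norm (P + t *\<^sub>R w) > 0" "norm (P - t *\<^sub>R w) > 0" by auto
  qed
  have sgnw: "w \<bullet> y \<noteq> 0 \<Longrightarrow> sgn (w \<bullet> y) = sgn (w \<bullet> Q)" if y: "y \<in> great_arc P Q" for y
  proof -
    assume "w \<bullet> y \<noteq> 0"
    obtain r where r: "0 \<le> r" "r \<le> 1" "y = sgn ((1 - r) *\<^sub>R P + r *\<^sub>R Q)"
      using y by (rule great_arcE)
    have "w \<bullet> y = r / norm ((1 - r) *\<^sub>R P + r *\<^sub>R Q) * (w \<bullet> Q)" 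
      using wP by (simp add: r(3) inner_sgn_right inner_add_right)
    moreover have "r / norm ((1 - r) *\<^sub>R P + r *\<^sub>R Q) > 0" 
      using r \<open>w \<bullet> y \<noteq> 0\<close> calculation by (metis divide_nonneg_nonneg less_eq_real_def mult_eq_0_iff norm_ge_zero)
    ultimately show "sgn (w \<bullet> y) = sgn (w \<bullet> Q)" by (metis mult_1 sgn_mult sgn_pos)
  qed
  have "w \<bullet> sgn (P + t *\<^sub>R w) > 0" "w \<bullet> sgn (P - t *\<^sub>R w) < 0"
    using wP ww assms nz by (auto simp: inner_sgn_right inner_add_right inner_diff_right divide_neg_pos)
  then have "sgn (w \<bullet> Q) = 1" "sgn (w \<bullet> Q) = -1"
    using sgnw[OF assms(5)] sgnw[OF assms(6)] by (auto simp: sgn_if)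
  then show False by simp
qed

lemma S2_independent:
  fixes P Q :: point
  assumes "P \<in> S2" "Q \<in> S2" "P \<noteq> Q" "P \<noteq> - Q" "\<alpha> *\<^sub>R P + \<beta> *\<^sub>R Q = 0"
  shows "\<alpha> = 0 \<and> \<beta> = 0"
proof -
  have "\<bar>P \<bullet> Q\<bar> < 1" using S2_inner_less_1[of P Q] S2_inner_gt_m1[of P Q] assms by (auto simp: abs_if)
  moreover have "P \<bullet> (\<alpha> *\<^sub>R P + \<beta> *\<^sub>R Q) = 0" "Q \<bullet> (\<alpha> *\<^sub>R P + \<beta> *\<^sub>R Q) = 0"
    using assms(5) by auto
  then have 1: "\<alpha> + \<beta> * (P \<bullet> Q) = 0" "\<alpha> * (P \<bullet> Q) + \<beta> = 0"
    using S2_inner_self[OF assms(1)] S2_inner_self[OF assms(2)]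
    by (auto simp: inner_add_right inner_commute)
  then have "\<beta> * (1 - (P \<bullet> Q)\<^sup>2) = 0" by algebra
  ultimately have "\<beta> = 0" by (metis abs_square_eq_1 eq_iff_diff_eq_0 less_irrefl mult_eq_0_iff)
  then show ?thesis using 1 by simp
qed

lemma great_arc_path:
  fixes P Q :: point
  assumes "P \<in> S2" "Q \<in> S2" "P \<noteq> Q" "P \<noteq> - Q"
  obtains g where "arc g" "path_image g = great_arc P Q"
proof -
  define g where "g = sgn \<circ> linepath P Q"
  have lp: "linepath P Q r \<noteq> 0" for r
    using S2_independent[OF assms, of "1 - r" r] by (auto simp: linepath_def)
  have "path g" unfolding path_def g_def
    by (auto simp: comp_def lp intro!: continuous_intros)
  moreover have "inj_on g {0..1}"
  proof (rule inj_onI)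
    fix r r' assume "g r = g r'"
    define k where "k = norm (linepath P Q r) / norm (linepath P Q r')"
    have "linepath P Q r = norm (linepath P Q r) *\<^sub>R sgn (linepath P Q r)"
      by (simp add: sgn_div_norm lp)
    also have "\<dots> = norm (linepath P Q r) *\<^sub>R sgn (linepath P Q r')"
      using \<open>g r = g r'\<close> by (simp add: g_def)
    also have "\<dots> = k *\<^sub>R linepath P Q r'" by (simp add: k_def sgn_div_norm divide_inverse)
    finally have "((1 - r) - k * (1 - r')) *\<^sub>R P + (r - k * r') *\<^sub>R Q = 0"
      by (simp add: linepath_def algebra_simps)
    then have "(1 - r) - k * (1 - r') = 0" "r - k * r' = 0"
      using S2_independent[OF assms] by blast+
    then show "r = r'" by (metis add_diff_cancel_left' diff_add_cancel eq_iff_diff_eq_0 mult_1 mult.right_neutral right_diff_distrib)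
  qed
  ultimately have "arc g" by (simp add: arc_def)
  moreover have "path_image g = great_arc P Q"
    by (auto simp: g_def great_arc_def path_image_compose)
  ultimately show ?thesis using that by blast
qed

subsection \<open>Polars of complete bodies\<close>

lemma sphere_interior_iff:
  "P \<in> sphere_interior X \<longleftrightarrow> P \<in> S2 \<and> (\<exists>r>0. \<forall>Q\<in>S2. dist Q P < r \<longrightarrow> Q \<in> X)"
proof
  assume "P \<in> sphere_interior X"
  then obtain T where T: "openin (top_of_set S2) T" "P \<in> T" "T \<subseteq> X"
    by (auto simp: interior_of_def)
  then obtain r where r: "r > 0" "ball P r \<inter> S2 \<subseteq> T" and P: "P \<in> S2"
    unfolding openin_contains_ball by blast
  have "Q \<in> X" if "Q \<in> S2" "dist Q P < r" for Q
  proof -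
    have "Q \<in> ball P r \<inter> S2" using that by (simp add: dist_commute)
    then show ?thesis using r(2) T(3) by blast
  qed
  then show "P \<in> S2 \<and> (\<exists>r>0. \<forall>Q\<in>S2. dist Q P < r \<longrightarrow> Q \<in> X)"
    using P r(1) by blast
next
  assume "P \<in> S2 \<and> (\<exists>r>0. \<forall>Q\<in>S2. dist Q P < r \<longrightarrow> Q \<in> X)"
  then obtain r where r: "P \<in> S2" "r > 0" "\<forall>Q\<in>S2. dist Q P < r \<longrightarrow> Q \<in> X" by blast
  have "openin (top_of_set S2) (S2 \<inter> ball P r)" by (simp add: openin_open_Int)
  moreover have "P \<in> S2 \<inter> ball P r" "S2 \<inter> ball P r \<subseteq> X" using r by (auto simp: dist_commute)
  ultimately show "P \<in> sphere_interior X" unfolding interior_of_def by blast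
qed

lemma sphere_boundary_closed:
  assumes "closed X" "X \<subseteq> S2"
  shows "sphere_boundary X = X - sphere_interior X"
proof -
  have "closedin (top_of_set S2) X" using assms by (simp add: closed_subset)
  then show ?thesis by (simp add: frontier_of_def closure_of_closedin)
qed

lemma not_interior_zero:
  assumes "Q \<in> S2" "\<And>x. x \<in> X \<Longrightarrow> 0 \<le> Q \<bullet> x" "Q \<bullet> P = 0"
  shows "P \<notin> sphere_interior X"
proof
  assume "P \<in> sphere_interior X"
  then obtain r where r: "P \<in> S2" "r > 0" "\<And>Q. Q \<in> S2 \<Longrightarrow> dist Q P < r \<Longrightarrow> Q \<in> X"
    by (auto simp: sphere_interior_iff)
  have "\<forall>\<^sub>F t in at_right 0. dist (sgn (P + t *\<^sub>R - Q)) P < r \<and> P + t *\<^sub>R - Q \<noteq> 0"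
    by (intro eventually_conj tendstoD[OF sgn_perturb_tendsto] eventually_perturb_nonzero r)
  then obtain t where t: "t > 0" "dist (sgn (P + t *\<^sub>R - Q)) P < r" "P + t *\<^sub>R - Q \<noteq> 0"
    by (rule ex_eventually_at_right_0) auto
  then have "0 \<le> Q \<bullet> sgn (P + t *\<^sub>R - Q)" by (intro assms(2) r(3) sgn_in_S2)
  moreover have "Q \<bullet> (P + t *\<^sub>R - Q) < 0"
    using assms(3) S2_inner_self[OF assms(1)] t by (simp add: inner_diff_right)
  ultimately show False using t(3) by (simp add: inner_sgn_right zero_le_divide_iff)
qed

text \<open>Both boundary conditions of \<open>supports_at\<close> come down to a zero inner
  product: if \<open>Q \<bullet> P > 0\<close>, the neighbourhood of \<open>P\<close> of radius
  \<open>Q \<bullet> P\<close> lies in the hemisphere, while \<open>Q \<bullet> P = 0\<close>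
  excludes \<open>P\<close> from the interior of the hemisphere and of \<open>X\<close>
  alike.\<close>

lemma supporting_iff:
  assumes "closed X" "X \<subseteq> S2"
  shows "supporting Q X \<longleftrightarrow> Q \<in> caps 0 X \<and> (\<exists>x\<in>X. Q \<bullet> x = 0)"
proof
  assume "supporting Q X"
  then obtain P where P: "Q \<in> S2" "X \<subseteq> hemisphere Q" "P \<in> X" "P \<in> sphere_boundary (hemisphere Q)"
    by (auto simp: supporting_def supports_at_def)
  have hs: "hemisphere Q = caps 0 {Q}" by (simp add: hemisphere_def caps_def)
  have cl: "closed (hemisphere Q)" "hemisphere Q \<subseteq> S2"
    by (simp_all only: hs closed_caps caps_subset_S2)
  have "P \<notin> sphere_interior (hemisphere Q)" using P(4) sphere_boundary_closed[OF cl] by blast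
  moreover have PS: "P \<in> S2" using P(3) assms by blast
  ultimately have no: "\<not> (\<exists>r>0. \<forall>R\<in>S2. dist R P < r \<longrightarrow> R \<in> hemisphere Q)"
    by (simp add: sphere_interior_iff)
  have "Q \<bullet> P = 0"
  proof (rule ccontr)
    assume "Q \<bullet> P \<noteq> 0"
    then have pos: "Q \<bullet> P > 0" using P(2,3) by (force simp: hemisphere_def)
    have "R \<in> hemisphere Q" if "R \<in> S2" "dist R P < Q \<bullet> P" for R
    proof -
      have "Q \<bullet> (P - R) \<le> norm Q * norm (P - R)" by (rule norm_cauchy_schwarz)
      then have "Q \<bullet> P - Q \<bullet> R < Q \<bullet> P"
        using that P(1) by (simp add: inner_diff_right dist_norm norm_minus_commute)
      then show ?thesis using that by (simp add: hemisphere_def)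
    qed
    then show False using no pos by blast
  qed
  then show "Q \<in> caps 0 X \<and> (\<exists>x\<in>X. Q \<bullet> x = 0)"
    using P by (auto simp: caps_def hemisphere_def inner_commute)
next
  assume "Q \<in> caps 0 X \<and> (\<exists>x\<in>X. Q \<bullet> x = 0)"
  then obtain P where Q: "Q \<in> S2" "\<And>x. x \<in> X \<Longrightarrow> 0 \<le> Q \<bullet> x" and P: "P \<in> X" "Q \<bullet> P = 0"
    by (auto simp: caps_def inner_commute)
  have hs: "hemisphere Q = caps 0 {Q}" by (simp add: hemisphere_def caps_def)
  have cl: "closed (hemisphere Q)" "hemisphere Q \<subseteq> S2"
    by (simp_all only: hs closed_caps caps_subset_S2)
  have sub: "X \<subseteq> hemisphere Q" using Q assms by (auto simp: hemisphere_def)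
  have "P \<notin> sphere_interior (hemisphere Q)"
    by (rule not_interior_zero[OF Q(1) _ P(2)]) (simp add: hemisphere_def)
  moreover have "P \<notin> sphere_interior X"
    by (rule not_interior_zero[OF Q(1) _ P(2)]) (rule Q(2))
  ultimately have "P \<in> sphere_boundary (hemisphere Q)" "P \<in> sphere_boundary X"
    unfolding sphere_boundary_closed[OF cl] sphere_boundary_closed[OF assms] using P sub by auto
  then show "supporting Q X" using Q sub P by (auto simp: supporting_def supports_at_def)
qed

lemma sphere_boundary_caps_0:
  assumes "compact K" "K \<subseteq> S2"
  shows "sphere_boundary (caps 0 K) = {y \<in> caps 0 K. \<exists>x\<in>K. x \<bullet> y = 0}"
proof -
  have "y \<in> sphere_interior (caps 0 K)" if y: "y \<in> caps 0 K" and nz: "\<And>x. x \<in> K \<Longrightarrow> x \<bullet> y \<noteq> 0" for y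
  proof -
    have "\<And>x. x \<in> K \<Longrightarrow> 0 < x \<bullet> y" using y nz by (force simp: caps_def)
    then obtain r where "r > 0" "\<And>Q x. dist Q y < r \<Longrightarrow> x \<in> K \<Longrightarrow> 0 < x \<bullet> Q"
      using strict_bound_near[OF assms, of 0 y] by blast
    then show ?thesis using y less_imp_le unfolding sphere_interior_iff caps_def by blast
  qed
  moreover have "y \<notin> sphere_interior (caps 0 K)" if "x \<in> K" "x \<bullet> y = 0" for x y
    using that assms(2) by (intro not_interior_zero[of x]) (auto simp: caps_def)
  ultimately show ?thesis
    unfolding sphere_boundary_closed[OF closed_caps caps_subset_S2] by blast
qed

text \<open>The equation \<open>dual\<close> packs two properties:
  \<open>K \<subseteq> caps c K\<close> bounds the diameter by \<open>arccos c\<close>, and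
  \<open>caps c K \<subseteq> K\<close> is completeness. The locale covers the polar of the given
  body as well as the Reuleaux polygons.\<close>

locale self_dual =
  fixes c :: real and K :: "point set"
  assumes c_pos: "0 < c" and c_less_1: "c < 1"
    and dual: "caps c K = K"
    and two_points: "\<exists>a\<in>K. \<exists>b\<in>K. a \<noteq> b"
begin

lemma K_S2: "K \<subseteq> S2"
  using dual caps_subset_S2 by blast

lemma K_ge: "x \<in> K \<Longrightarrow> y \<in> K \<Longrightarrow> c \<le> x \<bullet> y"
  using dual capsD by blast

lemma compact_K: "compact K"
  using dual compact_caps by metis

text \<open>Geometrically, the disc of radius \<open>\<pi> / 2 - arccos c\<close> about a point \<open>g\<close> of \<open>K\<close> lies in the
  polar of \<open>K\<close>.\<close>

lemma polar_of_member:
  assumes "g \<in> K" "x \<in> S2"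
  shows "g - c *\<^sub>R x \<noteq> 0" "sgn (g - c *\<^sub>R x) \<in> caps 0 K"
proof -
  have "norm (c *\<^sub>R x) < norm g" using assms K_S2 c_pos c_less_1 by auto
  then show nz: "g - c *\<^sub>R x \<noteq> 0" by auto
  have "0 \<le> x' \<bullet> (g - c *\<^sub>R x)" if x': "x' \<in> K" for x'
  proof -
    have "c * (x' \<bullet> x) \<le> c * 1"
      using S2_inner_le_1 x' assms K_S2 c_pos by (intro mult_left_mono) auto
    then show ?thesis using K_ge[OF x' assms(1)] by (simp add: inner_diff_right)
  qed
  then show "sgn (g - c *\<^sub>R x) \<in> caps 0 K"
    using sgn_in_S2[OF nz] by (auto simp: caps_def inner_sgn_right)
qed

text \<open>Completeness takes the place of a separation theorem. Testing a bipolar point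
  \<open>P\<close> against the polar point along \<open>g - c *\<^sub>R P\<close> gives
  \<open>c \<le> g \<bullet> P\<close> for every \<open>g\<close> in \<open>K\<close>, which is
  membership in \<open>caps c K\<close>.\<close>

lemma bipolar: "caps 0 (caps 0 K) = K"
proof
  show "K \<subseteq> caps 0 (caps 0 K)" using K_S2 by (auto simp: caps_def inner_commute)
  show "caps 0 (caps 0 K) \<subseteq> K"
  proof
    fix P assume P: "P \<in> caps 0 (caps 0 K)"
    have PS: "P \<in> S2" using P by (rule caps_in_S2)
    have "c \<le> g \<bullet> P" if g: "g \<in> K" for g
    proof -
      have "0 \<le> sgn (g - c *\<^sub>R P) \<bullet> P"
        using capsD[OF P polar_of_member(2)[OF g PS]] .
      then have "0 \<le> (g - c *\<^sub>R P) \<bullet> P"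
        using polar_of_member(1)[OF g PS]
        by (simp add: inner_commute[of _ P] inner_sgn_right zero_le_divide_iff)
      then show ?thesis using S2_inner_self[OF PS] by (simp add: inner_diff_left)
    qed
    then have "P \<in> caps c K" using PS by (auto simp: caps_def)
    then show "P \<in> K" using dual by simp
  qed
qed

text \<open>The midpoint of two distinct points works. Before normalisation its inner products with
  \<open>K\<close> are at least \<open>2 * c\<close>, and \<open>norm (a + b) < 2\<close>, so
  \<open>c' = 2 * c / norm (a + b)\<close> exceeds \<open>c\<close>. The slack \<open>c' - c\<close>
  makes \<open>z\<close> a quantitative interior point.\<close>

lemma centre:
  obtains z c' where "z \<in> K" "c' > c" "\<And>x. x \<in> K \<Longrightarrow> c' \<le> z \<bullet> x"
proof -
  obtain a b where ab: "a \<in> K" "b \<in> K" "a \<noteq> b" using two_points by blast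
  then have S: "a \<in> S2" "b \<in> S2" using K_S2 by auto
  have "norm (a + b) ^ 2 = 2 + 2 * (a \<bullet> b)"
    using S by (simp add: power2_norm_eq_inner inner_add_left inner_add_right inner_commute S2_inner_self
        del: mem_sphere_0)
  moreover have "a \<bullet> b < 1" "a \<bullet> b > 0" using S2_inner_less_1 S ab K_ge[of a b] c_pos by auto
  ultimately have n: "norm (a + b) ^ 2 < 2 ^ 2" "a + b \<noteq> 0" by auto
  then have n2: "norm (a + b) < 2" "norm (a + b) > 0"
    using power_less_imp_less_base[OF n(1)] by auto
  have bd: "2 * c / norm (a + b) \<le> sgn (a + b) \<bullet> x" if "x \<in> K" for x
    using K_ge[OF ab(1) that] K_ge[OF ab(2) that] n2
    by (simp add: inner_commute[of _ x] inner_sgn_right inner_add_right divide_right_mono)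
  moreover have gt: "2 * c / norm (a + b) > c"
    using n2 c_pos by (simp add: pos_less_divide_eq)
  moreover have "sgn (a + b) \<in> caps c K"
    using sgn_in_S2[OF n(2)] bd gt by (force simp: caps_def inner_commute)
  ultimately show ?thesis using that dual by blast
qed

text \<open>If \<open>z \<bullet> y\<close> were 0, a small push of \<open>z\<close> against
  \<open>y\<close> would keep the slack constraints, hence stay in \<open>K\<close>, yet give a
  negative inner product with \<open>y\<close>. So the polar lies in an open hemisphere.\<close>

lemma interior_member_polar_pos:
  assumes z: "z \<in> K" "c' > c" "\<And>x. x \<in> K \<Longrightarrow> c' \<le> z \<bullet> x" and y: "y \<in> caps 0 K"
  shows "z \<bullet> y > 0"
proof (rule ccontr)
  assume "\<not> z \<bullet> y > 0"
  then have 0: "z \<bullet> y = 0" using capsD[OF y z(1)] by simp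
  have zS: "z \<in> S2" using z K_S2 by blast
  have "\<And>x. x \<in> K \<Longrightarrow> c < x \<bullet> z" using z by (force simp: inner_commute)
  then have "\<forall>\<^sub>F t in at_right 0. (\<forall>x\<in>K. c < x \<bullet> sgn (z + t *\<^sub>R - y)) \<and> z + t *\<^sub>R - y \<noteq> 0"
    by (intro eventually_conj eventually_perturb_bound eventually_perturb_nonzero zS K_S2 compact_K)
  then obtain t where t: "t > 0" "\<And>x. x \<in> K \<Longrightarrow> c < x \<bullet> sgn (z + t *\<^sub>R - y)" "z + t *\<^sub>R - y \<noteq> 0"
    by (rule ex_eventually_at_right_0) auto
  then have "sgn (z + t *\<^sub>R - y) \<in> caps c K"
    using sgn_in_S2[OF t(3)] by (force simp: caps_def)
  then have "0 \<le> sgn (z + t *\<^sub>R - y) \<bullet> y" using dual capsD[OF y] by simp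
  moreover have "y \<bullet> (z + t *\<^sub>R - y) < 0"
    using 0 S2_inner_self[OF caps_in_S2[OF y]] t by (simp add: inner_diff_right inner_commute)
  ultimately show False using t(3)
    by (simp add: inner_commute[of _ y] inner_sgn_right zero_le_divide_iff)
qed

lemma ex_polar_pos:
  obtains z where "z \<in> S2" "\<And>y. y \<in> caps 0 K \<Longrightarrow> z \<bullet> y > 0"
  using centre interior_member_polar_pos K_S2 by (metis subsetD)

lemma spherical_convex_body_polar: "spherical_convex_body (caps 0 K)"
proof -
  obtain z where z: "z \<in> S2" "\<And>y. y \<in> caps 0 K \<Longrightarrow> z \<bullet> y > 0" by (rule ex_polar_pos) blast
  have "hemispherical (caps 0 K)"
  proof -
    have "hemisphere (- z) \<inter> caps 0 K = {}" using z(2) by (fastforce simp: hemisphere_def)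
    then show ?thesis using z(1) caps_subset_S2 unfolding hemispherical_def
      by (metis S2_norm norm_minus_cancel)
  qed
  moreover have "great_arc p q \<subseteq> caps 0 K" if "p \<in> caps 0 K" "q \<in> caps 0 K" for p q
    using that z by (intro caps_great_arc) auto
  moreover obtain a where a: "a \<in> K" using two_points by blast
  have "a \<in> sphere_interior (caps 0 K)"
  proof -
    have "\<And>x. x \<in> K \<Longrightarrow> 0 < x \<bullet> a" using K_ge a c_pos by force
    then obtain r where "r > 0" "\<And>Q x. dist Q a < r \<Longrightarrow> x \<in> K \<Longrightarrow> 0 < x \<bullet> Q"
      using strict_bound_near[OF compact_K K_S2, of 0 a] by blast
    then show ?thesis using a K_S2 less_imp_le unfolding sphere_interior_iff caps_def by blast
  qed
  ultimately show ?thesis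
    unfolding spherical_convex_body_def spherical_convex_def
    using closed_caps caps_subset_S2 by (auto simp: closed_subset)
qed

text \<open>Without a point of \<open>K\<close> at distance \<open>arccos c\<close>, all constraints
  would be slack at \<open>P\<close>; moving \<open>P\<close> against \<open>y\<close> would then
  stay in \<open>caps c K = K\<close> but violate \<open>y\<close>. This is what makes the width of
  the polar constant.\<close>

lemma boundary_partner:
  assumes P: "P \<in> K" and y: "y \<in> caps 0 K" "P \<bullet> y = 0"
  obtains Q where "Q \<in> K" "P \<bullet> Q = c"
proof -
  have PS: "P \<in> S2" using P K_S2 by blast
  have "\<exists>Q\<in>K. Q \<bullet> P \<le> c"
  proof (rule ccontr)
    assume "\<not> ?thesis"
    then have "\<And>x. x \<in> K \<Longrightarrow> c < x \<bullet> P" by force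
    then have "\<forall>\<^sub>F t in at_right 0. (\<forall>x\<in>K. c < x \<bullet> sgn (P + t *\<^sub>R - y)) \<and> P + t *\<^sub>R - y \<noteq> 0"
      by (intro eventually_conj eventually_perturb_bound eventually_perturb_nonzero PS K_S2 compact_K)
    then obtain t where t: "t > 0" "\<And>x. x \<in> K \<Longrightarrow> c < x \<bullet> sgn (P + t *\<^sub>R - y)" "P + t *\<^sub>R - y \<noteq> 0"
      by (rule ex_eventually_at_right_0) auto
    then have "sgn (P + t *\<^sub>R - y) \<in> caps c K"
      using sgn_in_S2[OF t(3)] by (force simp: caps_def)
    then have "0 \<le> sgn (P + t *\<^sub>R - y) \<bullet> y" using dual capsD[OF y(1)] by simp
    moreover have "y \<bullet> (P + t *\<^sub>R - y) < 0"
      using y(2) S2_inner_self[OF caps_in_S2[OF y(1)]] t by (simp add: inner_diff_right inner_commute)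
    ultimately show False using t(3)
      by (simp add: inner_commute[of _ y] inner_sgn_right zero_le_divide_iff)
  qed
  then show ?thesis using that K_ge[OF _ P] by (metis inner_commute order_antisym)
qed

lemma supporting_polar_iff:
  "supporting P (caps 0 K) \<longleftrightarrow> P \<in> K \<and> (\<exists>y\<in>caps 0 K. P \<bullet> y = 0)"
  using supporting_iff[OF closed_caps caps_subset_S2] bipolar by simp

lemma constant_width_polar: "constant_width (caps 0 K) (pi - arccos c)"
  unfolding constant_width_def
proof (intro allI impI)
  fix P assume "supporting P (caps 0 K)"
  then obtain y where P: "P \<in> K" and y: "y \<in> caps 0 K" "P \<bullet> y = 0"
    by (auto simp: supporting_polar_iff)
  obtain Q where Q: "Q \<in> K" "P \<bullet> Q = c" using boundary_partner[OF P y] .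
  have S: "P \<in> S2" "Q \<in> S2" using P Q K_S2 by auto
  \<comment> \<open>\<open>sgn (P - c *\<^sub>R Q)\<close> is where the hemisphere about
    \<open>Q\<close> touches the polar: it is a polar point by \<open>polar_of_member\<close>, and
    orthogonal to \<open>Q\<close> because \<open>P \<bullet> Q = c\<close>. Hence \<open>Q\<close>
    takes part in the minimum that defines the width.\<close>
  have "Q \<bullet> sgn (P - c *\<^sub>R Q) = 0"
    using Q S2_inner_self[OF S(2)] by (simp add: inner_sgn_right inner_diff_right inner_commute)
  then have "supporting Q (caps 0 K)"
    using polar_of_member(2)[OF P S(2)] Q by (auto simp: supporting_polar_iff)
  moreover have "Q \<noteq> P" "Q \<noteq> - P" using Q S2_inner_self[OF S(1)] c_pos c_less_1 by auto
  moreover have "lune_thickness P Q = pi - arccos c" using Q by (simp add: lune_thickness_def sdist_def)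
  moreover have "pi - arccos c \<le> lune_thickness P Q'" if "supporting Q' (caps 0 K)" for Q'
  proof -
    have "Q' \<in> K" using that by (simp add: supporting_polar_iff)
    then have "c \<le> P \<bullet> Q'" "P \<bullet> Q' \<le> 1" using K_ge[OF P] S2_inner_le_1 S K_S2 by auto
    then show ?thesis using c_pos by (simp add: lune_thickness_def sdist_def arccos_le_arccos)
  qed
  ultimately show "width P (caps 0 K) = pi - arccos c"
    unfolding width_def by (intro Least_equality) (metis, auto)
qed

end

subsection \<open>The polar of a body of constant width\<close>

lemma exists_not_proportional:
  fixes z :: point
  obtains x where "x \<in> S2" "x \<noteq> z" "x \<noteq> - z"
proof -
  define a b :: point where "a = axis 1 1" and "b = axis 2 1"
  have "a \<in> S2" "b \<in> S2" by (simp_all add: a_def b_def norm_axis_1)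
  moreover have "a \<noteq> b" "a \<noteq> - b"
    by (auto simp: a_def b_def axis_def vec_eq_iff)
  ultimately show ?thesis using that[of a] that[of b] by (metis minus_minus)
qed

locale spherical_body =
  fixes C :: "point set"
  assumes body: "spherical_convex_body C"
begin

lemma C_S2: "C \<subseteq> S2"
  using body by (simp add: spherical_convex_body_def spherical_convex_def hemispherical_def)

lemma closed_C: "closed C"
  using body closedin_closed_trans[OF _ closed_sphere] unfolding spherical_convex_body_def by blast

lemma compact_C: "compact C"
  using closed_C C_S2 by (metis compact_Int_closed compact_sphere inf.absorb_iff2)

lemma C_great_arc: "p \<in> C \<Longrightarrow> q \<in> C \<Longrightarrow> great_arc p q \<subseteq> C"
  using body by (simp add: spherical_convex_body_def spherical_convex_def)

lemma ex_strictly_positive: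
  obtains z where "z \<in> S2" "\<And>x. x \<in> C \<Longrightarrow> 0 < x \<bullet> z"
proof -
  obtain P where P: "P \<in> S2" "hemisphere P \<inter> C = {}"
    using body by (auto simp: spherical_convex_body_def spherical_convex_def hemispherical_def)
  have "0 < x \<bullet> - P" if "x \<in> C" for x
    using P that C_S2 by (force simp: hemisphere_def inner_commute)
  then show ?thesis using that[of "- P"] P by simp
qed

text \<open>An interior point of \<open>C\<close> lies on no great circle bounding a hemisphere that
  contains \<open>C\<close>. This puts the polar into an open hemisphere and rules out antipodal
  centres, for which there is no lune.\<close>

lemma interior_point:
  obtains w where "w \<in> C" "\<And>Q. Q \<in> caps 0 C \<Longrightarrow> 0 < w \<bullet> Q"
proof -
  obtain w where w: "w \<in> sphere_interior C"
    using body by (auto simp: spherical_convex_body_def)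
  then have wC: "w \<in> C" using interior_of_subset by fastforce
  have "0 < w \<bullet> Q" if Q: "Q \<in> caps 0 C" for Q
  proof -
    have "Q \<bullet> w \<noteq> 0"
      using not_interior_zero[of Q C w] w Q by (auto simp: caps_def inner_commute)
    then show ?thesis using capsD[OF Q wC] by (simp add: inner_commute)
  qed
  then show ?thesis using that wC by blast
qed

lemma bipolar: "caps 0 (caps 0 C) = C"
proof
  show "C \<subseteq> caps 0 (caps 0 C)" using C_S2 by (auto simp: caps_def inner_commute)
  show "caps 0 (caps 0 C) \<subseteq> C"
  proof (rule subsetI, rule ccontr)
    fix y assume y: "y \<in> caps 0 (caps 0 C)" and yC: "y \<notin> C"
    have yS: "y \<in> S2" using y by (rule caps_in_S2)
    obtain z where z: "z \<in> S2" "\<And>x. x \<in> C \<Longrightarrow> 0 < x \<bullet> z" using ex_strictly_positive by blast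
    \<comment> \<open>\<open>W\<close> is the open cone over \<open>C\<close>, and \<open>R\<close>
      is the closed ray through \<open>y\<close>. Convexity of \<open>W\<close> confines the convex
      hull of \<open>C\<close> to it, and \<open>y \<notin> C\<close> keeps \<open>W\<close> off the
      ray, so the hull and the ray can be separated strictly.\<close>
    define W where "W = {t *\<^sub>R x | t x. t > 0 \<and> x \<in> C}"
    define R where "R = {v. v = (y \<bullet> v) *\<^sub>R y \<and> 0 \<le> y \<bullet> v}"
    have "convex W"
    proof (rule convexI)
      fix v1 v2 and \<alpha> \<beta> :: real
      assume "v1 \<in> W" "v2 \<in> W" and ab: "0 \<le> \<alpha>" "0 \<le> \<beta>" "\<alpha> + \<beta> = 1"
      then obtain t1 x1 t2 x2 where v: "v1 = t1 *\<^sub>R x1" "t1 > 0" "x1 \<in> C" "v2 = t2 *\<^sub>R x2" "t2 > 0" "x2 \<in> C"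
        by (auto simp: W_def)
      define v where "v = (\<alpha> * t1) *\<^sub>R x1 + (\<beta> * t2) *\<^sub>R x2"
      have "v \<bullet> z > 0"
      proof (cases "\<alpha> = 0")
        case True
        then show ?thesis using ab v z(2)[OF v(6)] by (simp add: v_def)
      next
        case False
        then have "\<alpha> * t1 * (x1 \<bullet> z) > 0" "\<beta> * t2 * (x2 \<bullet> z) \<ge> 0"
          using ab v z(2)[OF v(3)] z(2)[OF v(6)] by auto
        then show ?thesis by (simp add: v_def inner_add_left)
      qed
      then have nz: "v \<noteq> 0" by auto
      have "sgn v \<in> C"
        using great_arc_conic[of "\<alpha> * t1" "\<beta> * t2" x1 x2] C_great_arc[OF v(3,6)] ab v nz
        unfolding v_def by auto
      moreover have "v = norm v *\<^sub>R sgn v" by (simp add: norm_scaleR_sgn)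
      ultimately have "v \<in> W" unfolding W_def using nz by (metis (mono_tags, lifting) mem_Collect_eq zero_less_norm_iff)
      then show "\<alpha> *\<^sub>R v1 + \<beta> *\<^sub>R v2 \<in> W" by (simp add: v_def v)
    qed
    moreover have "C \<subseteq> W" unfolding W_def by (force intro: exI[of _ 1])
    ultimately have hull: "convex hull C \<subseteq> W" by (rule hull_minimal[rotated])
    have "closed R" unfolding R_def
      by (intro closed_Collect_conj closed_Collect_eq closed_Collect_le continuous_intros)
    moreover have "convex R"
      by (rule convexI) (auto simp: R_def inner_add_right scaleR_add_left, metis scaleR_scaleR)
    moreover have "R \<inter> convex hull C = {}"
    proof (rule ccontr)
      assume "R \<inter> convex hull C \<noteq> {}"
      then obtain v where v: "v \<in> R" "v \<in> W" using hull by auto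
      obtain t x where tx: "v = t *\<^sub>R x" "t > 0" "x \<in> C" using v(2) by (auto simp: W_def)
      have x0: "x \<in> S2" using tx C_S2 by blast
      have "v = (y \<bullet> v) *\<^sub>R y" "0 \<le> y \<bullet> v" using v(1) unfolding R_def by blast+
      moreover have "v \<noteq> 0" using tx x0 by auto
      ultimately have "sgn v = y" using yS by (metis less_eq_real_def scale_zero_left scaleR_one sgn_S2 sgn_pos sgn_scaleR)
      moreover have "sgn v = x" using tx x0 sgn_S2 by (simp add: sgn_scaleR)
      ultimately show False using tx yC by simp
    qed
    moreover obtain w where "w \<in> C" using interior_point by blast
    ultimately obtain a b where ab: "\<And>v. v \<in> R \<Longrightarrow> a \<bullet> v < b" "\<And>v. v \<in> convex hull C \<Longrightarrow> b < a \<bullet> v"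
      using separating_hyperplane_closed_compact[of R "convex hull C"] compact_convex_hull[OF compact_C]
      by (metis convex_convex_hull empty_iff hull_inc)
    have "0 \<in> R" by (simp add: R_def)
    then have b: "b > 0" using ab(1) by force
    have ay: "a \<bullet> y \<le> 0"
    proof (rule ccontr)
      assume "\<not> a \<bullet> y \<le> 0"
      moreover have "(b / (a \<bullet> y)) *\<^sub>R y \<in> R"
        using calculation b S2_inner_self[OF yS] by (simp add: R_def)
      ultimately show False using ab(1)[of "(b / (a \<bullet> y)) *\<^sub>R y"] by simp
    qed
    \<comment> \<open>The separating functional only satisfies \<open>a \<bullet> y \<le> 0\<close>.
      Subtracting \<open>b *\<^sub>R y\<close> makes it negative at \<open>y\<close> and costs at
      most \<open>b\<close> on \<open>C\<close>, where \<open>a\<close> exceeds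
      \<open>b\<close>.\<close>
    define a' where "a' = a - b *\<^sub>R y"
    have neg: "a' \<bullet> y < 0" using ay b S2_inner_self[OF yS] by (simp add: a'_def inner_diff_left)
    then have nz: "a' \<noteq> 0" by auto
    have "0 \<le> x \<bullet> a'" if x: "x \<in> C" for x
    proof -
      have "b * (x \<bullet> y) \<le> b * 1"
        using b x C_S2 yS S2_inner_le_1[of x y] by (intro mult_left_mono) auto
      moreover have "b < a \<bullet> x" using ab(2) hull_inc[OF x] by blast
      ultimately show ?thesis by (simp add: a'_def inner_diff_right inner_commute)
    qed
    then have "sgn a' \<in> caps 0 C" using sgn_in_S2[OF nz] by (auto simp: caps_def inner_sgn_right)
    then have "0 \<le> sgn a' \<bullet> y" by (rule capsD[OF y])
    then show False using neg nz by (simp add: inner_commute[of _ y] inner_sgn_right zero_le_divide_iff)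
  qed
qed

text \<open>If the polar point \<open>Q\<close> farthest from \<open>P\<close> were strictly
  positive on \<open>C\<close>, it could be moved farther away from \<open>P\<close> without leaving
  the polar.\<close>

lemma minimizer_supporting:
  assumes PQ: "P \<in> caps 0 C" "Q \<in> caps 0 C" "P \<bullet> Q < 1"
    and min: "\<And>R. R \<in> caps 0 C \<Longrightarrow> P \<bullet> Q \<le> P \<bullet> R"
  shows "supporting Q C"
proof (rule ccontr)
  assume "\<not> supporting Q C"
  then have nz: "\<And>x. x \<in> C \<Longrightarrow> Q \<bullet> x \<noteq> 0"
    using PQ by (auto simp: supporting_iff[OF closed_C C_S2])
  then have pos: "\<And>x. x \<in> C \<Longrightarrow> 0 < x \<bullet> Q"
    using capsD[OF PQ(2)] by (metis inner_commute order_le_less)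
  have S: "P \<in> S2" "Q \<in> S2" using PQ caps_in_S2 by auto
  obtain w where w: "\<And>Q. Q \<in> caps 0 C \<Longrightarrow> 0 < w \<bullet> Q" using interior_point by blast
  have "P \<noteq> - Q" using w[OF PQ(1)] w[OF PQ(2)] by auto
  then have lt: "\<bar>P \<bullet> Q\<bar> < 1" using S2_inner_gt_m1[OF S] PQ(3) by simp
  have "\<forall>\<^sub>F t in at_right 0. (\<forall>x\<in>C. 0 < x \<bullet> sgn (Q + t *\<^sub>R - P)) \<and> Q + t *\<^sub>R - P \<noteq> 0"
    by (intro eventually_conj eventually_perturb_bound eventually_perturb_nonzero S C_S2 compact_C pos)
  then obtain t where t: "t > 0" "\<And>x. x \<in> C \<Longrightarrow> 0 < x \<bullet> sgn (Q + t *\<^sub>R - P)" "Q + t *\<^sub>R - P \<noteq> 0"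
    by (rule ex_eventually_at_right_0) auto
  then have "sgn (Q - t *\<^sub>R P) \<in> caps 0 C"
    using sgn_in_S2[OF t(3)] by (force simp: caps_def)
  then show False using min move_away_decreases_inner[OF S lt t(1)] by fastforce
qed

lemma ex_minimizer:
  assumes "P \<in> caps 0 C"
  obtains Q where "Q \<in> caps 0 C" "\<And>R. R \<in> caps 0 C \<Longrightarrow> P \<bullet> Q \<le> P \<bullet> R"
proof -
  have "continuous_on (caps 0 C) (\<lambda>R. P \<bullet> R)" by (intro continuous_intros)
  then show ?thesis using that continuous_attains_inf[OF compact_caps, of 0 C] assms by blast
qed

text \<open>Needed because \<open>constant_width\<close> speaks only of supporting hemispheres. A
  point \<open>z\<close> that is strictly positive on \<open>C\<close> can be moved within the
  polar, so the polar point farthest from \<open>z\<close> differs from \<open>z\<close> and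
  therefore supports.\<close>

lemma ex_supporting:
  obtains P where "supporting P C"
proof -
  obtain z where z: "z \<in> S2" "\<And>x. x \<in> C \<Longrightarrow> 0 < x \<bullet> z" using ex_strictly_positive by blast
  then have zK: "z \<in> caps 0 C" by (force simp: caps_def)
  obtain P where P: "P \<in> S2" "P \<noteq> z" "P \<noteq> - z" using exists_not_proportional .
  have lt: "\<bar>P \<bullet> z\<bar> < 1" using S2_inner_less_1[of P z] S2_inner_gt_m1[of P z] P z by simp
  have "\<forall>\<^sub>F t in at_right 0. (\<forall>x\<in>C. 0 < x \<bullet> sgn (z + t *\<^sub>R - P)) \<and> z + t *\<^sub>R - P \<noteq> 0"
    by (intro eventually_conj eventually_perturb_bound eventually_perturb_nonzero z C_S2 compact_C)
  then obtain t where t: "t > 0" "\<And>x. x \<in> C \<Longrightarrow> 0 < x \<bullet> sgn (z + t *\<^sub>R - P)" "z + t *\<^sub>R - P \<noteq> 0"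
    by (rule ex_eventually_at_right_0) auto
  define z' where "z' = sgn (z - t *\<^sub>R P)"
  have "z' \<in> caps 0 C" using t sgn_in_S2[OF t(3)] by (force simp: caps_def z'_def)
  moreover have "z' \<noteq> z" using move_away_decreases_inner[OF P(1) z(1) lt t(1)] by (auto simp: z'_def)
  ultimately have "z \<bullet> z' < 1" "z' \<in> caps 0 C" using S2_inner_less_1[OF z(1)] caps_in_S2 by auto
  moreover obtain Q where "Q \<in> caps 0 C" "\<And>R. R \<in> caps 0 C \<Longrightarrow> z \<bullet> Q \<le> z \<bullet> R"
    using ex_minimizer[OF zK] by blast
  ultimately have "supporting Q C" using minimizer_supporting[OF zK] by (metis order_le_less_trans)
  then show ?thesis using that by blast
qed

text \<open>The minimum may be taken over the whole polar, because the polar point farthest from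
  \<open>P\<close> is itself the centre of a supporting hemisphere. In particular the
  \<open>LEAST\<close> value is attained.\<close>

lemma width_eq:
  assumes "supporting P C"
  obtains Q where "Q \<in> caps 0 C" "P \<bullet> Q < 1" "\<And>R. R \<in> caps 0 C \<Longrightarrow> P \<bullet> Q \<le> P \<bullet> R"
    "width P C = pi - arccos (P \<bullet> Q)"
proof -
  obtain x where P: "P \<in> caps 0 C" and x: "x \<in> C" "P \<bullet> x = 0"
    using assms supporting_iff[OF closed_C C_S2] by blast
  obtain Q where Q: "Q \<in> caps 0 C" "\<And>R. R \<in> caps 0 C \<Longrightarrow> P \<bullet> Q \<le> P \<bullet> R"
    using ex_minimizer[OF P] by blast
  obtain z where z: "z \<in> S2" "\<And>x. x \<in> C \<Longrightarrow> 0 < x \<bullet> z" using ex_strictly_positive by blast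
  then have zK: "z \<in> caps 0 C" by (force simp: caps_def)
  have S: "P \<in> S2" "Q \<in> S2" using P Q caps_in_S2 by auto
  have "P \<noteq> z" using z(2)[OF x(1)] x(2) by (auto simp: inner_commute)
  then have lt: "P \<bullet> Q < 1" using Q(2)[OF zK] S2_inner_less_1[OF S(1) z(1)] by simp
  have sup: "supporting Q C" using minimizer_supporting[OF P Q(1) lt Q(2)] .
  obtain w where w: "\<And>Q. Q \<in> caps 0 C \<Longrightarrow> 0 < w \<bullet> Q" using interior_point by blast
  have "Q \<noteq> P" "Q \<noteq> - P" using lt S2_inner_self[OF S(1)] w[OF P] w[OF Q(1)] by auto
  moreover have "lune_thickness P Q \<le> lune_thickness P R" if "supporting R C" for R
  proof -
    have "R \<in> caps 0 C" using that supporting_iff[OF closed_C C_S2] by blast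
    then have "P \<bullet> Q \<le> P \<bullet> R" "P \<bullet> R \<le> 1" "- 1 \<le> P \<bullet> Q"
      using Q(2) S2_inner_le_1 S2_abs_inner_le_1[OF S] S caps_in_S2 by fastforce+
    then show ?thesis by (simp add: lune_thickness_def sdist_def arccos_le_arccos)
  qed
  ultimately have "width P C = lune_thickness P Q"
    unfolding width_def using sup by (intro Least_equality) auto
  then show ?thesis using that Q lt by (simp add: lune_thickness_def sdist_def)
qed

text \<open>The hypothesis controls only supporting centres. The diameter bound extends to all polar
  points because farthest points support. For completeness, suppose \<open>y\<close> lies outside
  the polar but within \<open>arccos c\<close> of all its points. The chord from an interior point
  \<open>z\<close> to \<open>y\<close> leaves the polar at a supporting centre that is closer than
  \<open>arccos c\<close> to every polar point, whereas constant width gives it a partner at exactly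
  that distance.\<close>

lemma polar_self_dual:
  assumes tau: "\<tau> > pi / 2" and cw: "constant_width C \<tau>"
  shows "\<tau> < pi" "self_dual (- cos \<tau>) (caps 0 C)"
    "\<exists>a\<in>caps 0 C. \<exists>b\<in>caps 0 C. a \<bullet> b = - cos \<tau>"
proof -
  define c where "c = - cos \<tau>"
  have key: "\<exists>Q\<in>caps 0 C. P \<bullet> Q = c \<and> c < 1 \<and> \<tau> < pi \<and> (\<forall>R\<in>caps 0 C. c \<le> P \<bullet> R)"
    if P: "supporting P C" for P
  proof -
    obtain Q where Q: "Q \<in> caps 0 C" "P \<bullet> Q < 1" "\<And>R. R \<in> caps 0 C \<Longrightarrow> P \<bullet> Q \<le> P \<bullet> R"
      and w: "width P C = pi - arccos (P \<bullet> Q)"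
      using width_eq[OF P] by blast
    have "P \<in> caps 0 C" using P supporting_iff[OF closed_C C_S2] by blast
    then have S: "P \<in> S2" "Q \<in> S2" using Q caps_in_S2 by auto
    have PQ: "-1 \<le> P \<bullet> Q" "P \<bullet> Q \<le> 1" using S2_abs_inner_le_1[OF S] by auto
    have "\<tau> = pi - arccos (P \<bullet> Q)" using cw P w by (auto simp: constant_width_def)
    then have "P \<bullet> Q = c" using PQ by (simp add: c_def cos_arccos)
    moreover have "0 < arccos (P \<bullet> Q)"
      using arccos_less_arccos[of "P \<bullet> Q" 1] PQ Q(2) by simp
    ultimately show ?thesis using Q \<open>\<tau> = _\<close> by auto
  qed
  obtain P0 where P0: "supporting P0 C" using ex_supporting .
  obtain Q0 where Q0: "Q0 \<in> caps 0 C" "P0 \<bullet> Q0 = c" and c1: "c < 1" and tpi: "\<tau> < pi"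
    using key[OF P0] by blast
  have P0K: "P0 \<in> caps 0 C" using P0 supporting_iff[OF closed_C C_S2] by blast
  have c0: "c > 0" using tau tpi cos_lt_zero_pi[of \<tau>] cos_monotone_0_pi[of "pi/2" \<tau>] by (simp add: c_def)
  have ge: "c \<le> P \<bullet> R" if P: "P \<in> caps 0 C" and R: "R \<in> caps 0 C" for P R
  proof -
    obtain Q where Q: "Q \<in> caps 0 C" "\<And>R. R \<in> caps 0 C \<Longrightarrow> P \<bullet> Q \<le> P \<bullet> R"
      using ex_minimizer[OF P] by blast
    show ?thesis
    proof (cases "P \<bullet> Q < 1")
      case True
      then have "supporting Q C" using minimizer_supporting[OF P Q(1) _ Q(2)] by blast
      then have "c \<le> P \<bullet> Q" using key[of Q] P by (auto simp: inner_commute)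
      then show ?thesis using Q(2)[OF R] by linarith
    next
      case False
      then show ?thesis using Q(2)[OF R] c1 by linarith
    qed
  qed
  have "y \<in> caps 0 C" if y: "y \<in> caps c (caps 0 C)" for y
  proof (rule ccontr)
    assume ny: "y \<notin> caps 0 C"
    have yS: "y \<in> S2" using y caps_in_S2 by blast
    obtain z where z: "z \<in> S2" "\<And>x. x \<in> C \<Longrightarrow> 0 < x \<bullet> z" using ex_strictly_positive by blast
    then have zK: "z \<in> caps 0 C" by (force simp: caps_def)
    \<comment> \<open>A polar point at maximal distance from another one would support
      \<open>C\<close> by \<open>minimizer_supporting\<close>, which \<open>z\<close>, being
      strictly positive on \<open>C\<close>, does not.\<close>
    have zgt: "c < z \<bullet> R" if R: "R \<in> caps 0 C" for R
    proof (rule ccontr)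
      assume "\<not> c < z \<bullet> R"
      then have eq: "z \<bullet> R = c" using ge[OF zK R] by simp
      have "supporting z C"
        by (rule minimizer_supporting[OF R zK]) (use eq c1 ge[OF R] in \<open>auto simp: inner_commute\<close>)
      then show False using z(2) by (force simp: supporting_iff[OF closed_C C_S2] inner_commute)
    qed
    \<comment> \<open>The chord replaces the arc, so that every constraint is affine in
      \<open>r\<close>. Normalisation is postponed to the exit point \<open>p\<close>, where it only
      helps since \<open>norm (h r) \<le> 1\<close>.\<close>
    define h where "h r = (1 - r) *\<^sub>R z + r *\<^sub>R y" for r
    define A where "A = {r \<in> {0..1}. \<forall>x\<in>C. 0 \<le> x \<bullet> h r}"
    have A0: "0 \<in> A" using z(2) less_imp_le by (auto simp: A_def h_def)
    have "A = {0..1} \<inter> (\<Inter>x\<in>C. {r. 0 \<le> x \<bullet> h r})" by (auto simp: A_def)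
    moreover have "closed ({0..1} \<inter> (\<Inter>x\<in>C. {r. 0 \<le> x \<bullet> h r}))" unfolding h_def
      by (intro closed_Int closed_INT ballI closed_Collect_le continuous_intros)
    ultimately have "compact A" by (metis compact_Icc compact_Int_closed inf.absorb_iff2 inf_le1)
    then obtain r where r: "r \<in> A" "\<And>r'. r' \<in> A \<Longrightarrow> r' \<le> r"
      using compact_attains_sup[of A] A0 by blast
    have r1: "r < 1"
    proof (rule ccontr)
      assume "\<not> r < 1"
      then have "r = 1" using r(1) by (simp add: A_def)
      then show False using r(1) ny yS by (simp add: A_def h_def caps_def)
    qed
    have r0: "0 \<le> r" using r(1) by (simp add: A_def)
    have ca: "c < R \<bullet> h r" if R: "R \<in> caps 0 C" for R
    proof -
      have "(1 - r) * c < (1 - r) * (z \<bullet> R)" using zgt[OF R] r1 by simp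
      moreover have "r * c \<le> r * (R \<bullet> y)" using capsD[OF y R] r0 by (rule mult_left_mono)
      ultimately show ?thesis by (simp add: h_def inner_add_right inner_commute algebra_simps)
    qed
    have nz: "h r \<noteq> 0" using ca[OF zK] c0 by auto
    have n1: "norm (h r) \<le> 1"
      using norm_triangle_ineq[of "(1 - r) *\<^sub>R z" "r *\<^sub>R y"] r0 r1 z(1) yS by (simp add: h_def)
    define p where "p = sgn (h r)"
    have "\<exists>x\<in>C. x \<bullet> h r = 0"
    proof (rule ccontr)
      assume "\<not> ?thesis"
      then have "\<And>x. x \<in> C \<Longrightarrow> 0 < x \<bullet> h r" using r(1) by (force simp: A_def)
      then obtain e where e: "e > 0" "\<And>Q x. dist Q (h r) < e \<Longrightarrow> x \<in> C \<Longrightarrow> 0 < x \<bullet> Q"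
        using strict_bound_near[OF compact_C C_S2, of 0 "h r"] by blast
      have "isCont h r" unfolding h_def by (intro continuous_intros)
      then obtain d where d: "d > 0" "\<And>r'. dist r' r < d \<Longrightarrow> dist (h r') (h r) < e"
        using e(1) unfolding continuous_at_eps_delta by blast
      define r' where "r' = r + min (d / 2) (1 - r)"
      have "r' \<in> A" unfolding A_def
        using e(2)[OF d(2)[of r']] d(1) r0 r1 by (force simp: r'_def dist_real_def min_def)
      then show False using r(2)[of r'] d(1) r1 by (simp add: r'_def)
    qed
    then obtain x where x: "x \<in> C" "x \<bullet> h r = 0" by blast
    have "p \<in> caps 0 C" using r(1) sgn_in_S2[OF nz] by (auto simp: A_def p_def caps_def inner_sgn_right)
    moreover have "x \<bullet> p = 0" using x(2) by (simp add: p_def inner_sgn_right)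
    then have "p \<bullet> x = 0" by (simp only: inner_commute)
    ultimately have "supporting p C" unfolding supporting_iff[OF closed_C C_S2] using x(1) by blast
    then obtain Q where Q: "Q \<in> caps 0 C" "p \<bullet> Q = c" using key by blast
    have "c * norm (h r) \<le> c * 1" using n1 c0 by (intro mult_left_mono) auto
    then have "c < Q \<bullet> p" using ca[OF Q(1)] nz by (simp add: p_def inner_sgn_right pos_less_divide_eq)
    then show False using Q(2) by (simp add: inner_commute)
  qed
  moreover have "caps 0 C \<subseteq> caps c (caps 0 C)" using ge caps_subset_S2 by (auto simp: caps_def)
  ultimately have "caps c (caps 0 C) = caps 0 C" by blast
  moreover have "P0 \<noteq> Q0" using Q0 c1 S2_inner_self[OF caps_in_S2[OF Q0(1)]] by auto
  ultimately show "self_dual (- cos \<tau>) (caps 0 C)"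
    using c0 c1 P0K Q0 by unfold_locales (auto simp: c_def)
  show "\<tau> < pi" by (rule tpi)
  show "\<exists>a\<in>caps 0 C. \<exists>b\<in>caps 0 C. a \<bullet> b = - cos \<tau>"
    using P0K Q0 by (auto simp: c_def)
qed

end

subsection \<open>Completion of a finite set\<close>

lemma cross3_neq_0:
  assumes "a \<in> S2" "b \<in> S2" "\<bar>a \<bullet> b\<bar> < 1"
  shows "cross3 a b \<noteq> 0"
proof
  assume "cross3 a b = 0"
  then have "(a \<bullet> b)\<^sup>2 = 1" using norm_cross_dot[of a b] assms by simp
  then show False using assms(3) by (auto simp: power2_eq_1_iff)
qed

lemma plane_decomposition:
  assumes "a \<in> S2" "b \<in> S2" "\<bar>a \<bullet> b\<bar> < 1" "cross3 a b \<bullet> r = 0"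
  obtains \<alpha> \<beta> where "r = \<alpha> *\<^sub>R a + \<beta> *\<^sub>R b"
proof -
  define c where "c = a \<bullet> b"
  define \<alpha> where "\<alpha> = (a \<bullet> r - c * (b \<bullet> r)) / (1 - c\<^sup>2)"
  define \<beta> where "\<beta> = (b \<bullet> r - c * (a \<bullet> r)) / (1 - c\<^sup>2)"
  define d where "d = r - \<alpha> *\<^sub>R a - \<beta> *\<^sub>R b"
  have c: "1 - c\<^sup>2 \<noteq> 0" using assms(3) by (auto simp: c_def power2_eq_1_iff)
  have S: "a \<bullet> a = 1" "b \<bullet> b = 1" "b \<bullet> a = c" "a \<bullet> b = c"
    using S2_inner_self assms(1,2) by (auto simp: c_def inner_commute)
  have ab: "\<alpha> * (1 - c\<^sup>2) = a \<bullet> r - c * (b \<bullet> r)" "\<beta> * (1 - c\<^sup>2) = b \<bullet> r - c * (a \<bullet> r)"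
    using c by (simp_all add: \<alpha>_def \<beta>_def)
  have "(a \<bullet> d) * (1 - c\<^sup>2) = (a \<bullet> r) * (1 - c\<^sup>2) - \<alpha> * (1 - c\<^sup>2) - \<beta> * (1 - c\<^sup>2) * c"
    by (simp add: d_def inner_diff_right S algebra_simps)
  also have "\<dots> = 0" unfolding ab by (simp add: algebra_simps power2_eq_square)
  finally have "a \<bullet> d = 0" using c by simp
  moreover have "(b \<bullet> d) * (1 - c\<^sup>2) = (b \<bullet> r) * (1 - c\<^sup>2) - \<alpha> * (1 - c\<^sup>2) * c - \<beta> * (1 - c\<^sup>2)"
    by (simp add: d_def inner_diff_right S algebra_simps)
  then have "(b \<bullet> d) * (1 - c\<^sup>2) = 0" unfolding ab by (simp add: algebra_simps power2_eq_square)
  then have "b \<bullet> d = 0" using c by simp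
  moreover have "cross3 a b \<bullet> d = 0"
    using assms(4) by (simp add: d_def inner_diff_right dot_cross_self)
  ultimately have "d = 0" using orthogonal_basis_zero cross3_neq_0[OF assms(1-3)] by blast
  then show ?thesis using that[of \<alpha> \<beta>] by (simp add: d_def algebra_simps)
qed

lemma conic_inner_ge:
  fixes p :: point
  assumes "p \<in> S2" "u \<in> S2" "v \<in> S2" "p = \<alpha> *\<^sub>R u + \<beta> *\<^sub>R v" "0 \<le> \<alpha>" "0 \<le> \<beta>"
    and "0 \<le> k" "k \<le> y \<bullet> u" "k \<le> y \<bullet> v"
  shows "k \<le> y \<bullet> p"
proof -
  have "1 \<le> \<alpha> + \<beta>"
    using norm_triangle_ineq[of "\<alpha> *\<^sub>R u" "\<beta> *\<^sub>R v"] assms by simp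
  then have "k * 1 \<le> k * (\<alpha> + \<beta>)" using assms(7) by (rule mult_left_mono)
  also have "\<dots> \<le> \<alpha> * (y \<bullet> u) + \<beta> * (y \<bullet> v)"
    using mult_left_mono[OF assms(8,5)] mult_left_mono[OF assms(9,6)] by (simp add: algebra_simps)
  also have "\<dots> = y \<bullet> p" by (simp add: assms(4) inner_add_right)
  finally show ?thesis by simp
qed

text \<open>The bounds place \<open>p\<close> on the arc \<open>ab\<close> itself: for
  \<open>p = \<alpha> *\<^sub>R a + \<beta> *\<^sub>R b\<close>, unit length means \<open>(a
  \<bullet> p)\<^sup>2 + \<beta>\<^sup>2 * (1 - c\<^sup>2) = 1\<close>, so
  \<open>c \<le> a \<bullet> p\<close> forces \<open>\<beta> \<le> 1\<close> and hence
  \<open>\<alpha> = a \<bullet> p - \<beta> * c \<ge> 0\<close>; likewise for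
  \<open>\<beta>\<close>. Convexity of the disc about \<open>y\<close> does the rest.\<close>

lemma chord_inner_ge:
  assumes S: "a \<in> S2" "b \<in> S2" "p \<in> S2" and ab: "a \<bullet> b = c" and c: "0 < c" "c < 1"
    and p: "cross3 a b \<bullet> p = 0" "c \<le> a \<bullet> p" "c \<le> b \<bullet> p"
    and y: "c \<le> a \<bullet> y" "c \<le> b \<bullet> y"
  shows "c \<le> y \<bullet> p"
proof -
  have lt: "\<bar>a \<bullet> b\<bar> < 1" using ab c by simp
  obtain \<alpha> \<beta> where eq: "p = \<alpha> *\<^sub>R a + \<beta> *\<^sub>R b" using plane_decomposition[OF S(1,2) lt p(1)] .
  have pos: "0 \<le> \<alpha>'" if "p = \<alpha>' *\<^sub>R a' + \<beta>' *\<^sub>R b'" "a' \<in> S2" "b' \<in> S2" "a' \<bullet> b' = c" "c \<le> a' \<bullet> p"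
    for \<alpha>' \<beta>' a' b'
  proof (rule ccontr)
    assume neg: "\<not> 0 \<le> \<alpha>'"
    have I: "a' \<bullet> a' = 1" "b' \<bullet> b' = 1" "b' \<bullet> a' = c" "p \<bullet> p = 1"
      using that S2_inner_self S(3) by (auto simp: inner_commute)
    have ap: "a' \<bullet> p = \<alpha>' + \<beta>' * c" by (simp add: that(1,4) I inner_add_right)
    have "p \<bullet> p = (\<alpha>' + \<beta>' * c)\<^sup>2 + \<beta>'\<^sup>2 * (1 - c\<^sup>2)"
      unfolding that(1) by (simp add: inner_add_left inner_add_right I that(4) power2_eq_square algebra_simps)
    moreover have "c\<^sup>2 \<le> (\<alpha>' + \<beta>' * c)\<^sup>2" using that(5) c ap by (intro power_mono) auto
    ultimately have "\<beta>'\<^sup>2 * (1 - c\<^sup>2) \<le> 1 * (1 - c\<^sup>2)" using I(4) by simp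
    moreover have "1 - c\<^sup>2 > 0" using c by (simp add: power_less_one_iff)
    ultimately have "\<beta>'\<^sup>2 \<le> 1" using mult_le_cancel_right_pos by blast
    then have "\<beta>' \<le> 1" by (simp add: abs_le_square_iff[of \<beta>' 1, simplified, symmetric])
    then have "\<beta>' * c \<le> c" using c by simp
    then show False using neg that(5) ap by simp
  qed
  have "0 \<le> \<alpha>" using pos[OF eq S(1,2) ab p(2)] .
  moreover have "0 \<le> \<beta>" using pos[of \<beta> b \<alpha> a] eq S ab p(3) by (simp add: add.commute inner_commute)
  ultimately show ?thesis
    using conic_inner_ge[OF S(3,1,2) eq, of c y] c y by (simp add: inner_commute)
qed

text \<open>The part of a lens on one side of the diametral chord \<open>ab\<close> lies in a Reuleaux triangle, hence
  has no larger diameter. In the crossing case, where \<open>x p + \<beta> b = \<alpha> a + w q\<close>, adding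
  the inner products of this relation with \<open>p\<close> and with \<open>a\<close> gives the claim.\<close>

lemma half_lens_diameter:
  assumes S: "a \<in> S2" "b \<in> S2" "p \<in> S2" "q \<in> S2" and ab: "a \<bullet> b = c" and c: "0 < c" "c < 1"
    and p: "0 \<le> cross3 a b \<bullet> p" "c \<le> a \<bullet> p" "c \<le> b \<bullet> p"
    and q: "0 \<le> cross3 a b \<bullet> q" "c \<le> a \<bullet> q" "c \<le> b \<bullet> q"
  shows "c \<le> p \<bullet> q"
proof (cases "cross3 a b \<bullet> p = 0 \<or> cross3 a b \<bullet> q = 0")
  case True
  then show ?thesis
    using chord_inner_ge[OF S(1,2,3) ab c _ p(2,3) q(2,3)] chord_inner_ge[OF S(1,2,4) ab c _ q(2,3) p(2,3)]
    by (auto simp: inner_commute)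
next
  case False
  \<comment> \<open>With the weights \<open>x\<close> and \<open>w\<close>, the combination
    \<open>x *\<^sub>R p - w *\<^sub>R q\<close> lies in the plane of \<open>a\<close> and
    \<open>b\<close>; the signs of its two coefficients there distinguish the configurations of the
    four points.\<close>
  define x where "x = cross3 a b \<bullet> q"
  define w where "w = cross3 a b \<bullet> p"
  have xw: "x > 0" "w > 0" using False p q by (auto simp: x_def w_def)
  have lt: "\<bar>a \<bullet> b\<bar> < 1" using ab c by simp
  have "cross3 a b \<bullet> (x *\<^sub>R p - w *\<^sub>R q) = 0"
    by (simp add: inner_diff_right x_def w_def)
  then obtain \<alpha> \<beta> where eq: "x *\<^sub>R p - w *\<^sub>R q = \<alpha> *\<^sub>R a + \<beta> *\<^sub>R b"
    using plane_decomposition[OF S(1,2) lt] by blast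
  have crossing: "c \<le> p' \<bullet> q'"
    if S': "p' \<in> S2" "q' \<in> S2" "a' \<in> S2" "b' \<in> S2" and ab': "a' \<bullet> b' = c"
      and pq': "c \<le> b' \<bullet> p'" "c \<le> a' \<bullet> q'" and pos: "x' > 0" "w' > 0" "\<alpha>' \<ge> 0" "\<beta>' \<le> 0"
      and eq': "x' *\<^sub>R p' - w' *\<^sub>R q' = \<alpha>' *\<^sub>R a' + \<beta>' *\<^sub>R b'"
    for p' q' a' b' :: point and x' w' \<alpha>' \<beta>' :: real
  proof (rule ccontr)
    assume less: "\<not> c \<le> p' \<bullet> q'"
    define B where "B = - \<beta>'"
    have "p' \<bullet> (x' *\<^sub>R p' - w' *\<^sub>R q') = p' \<bullet> (\<alpha>' *\<^sub>R a' + \<beta>' *\<^sub>R b')"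
      "a' \<bullet> (x' *\<^sub>R p' - w' *\<^sub>R q') = a' \<bullet> (\<alpha>' *\<^sub>R a' + \<beta>' *\<^sub>R b')"
      by (simp_all only: eq')
    then have "x' - w' * (p' \<bullet> q') = \<alpha>' * (a' \<bullet> p') - B * (b' \<bullet> p')"
      "x' * (a' \<bullet> p') - w' * (a' \<bullet> q') = \<alpha>' - B * c"
      using S2_inner_self[OF S'(1)] S2_inner_self[OF S'(3)] ab'
      by (simp_all add: B_def inner_diff_right inner_add_right inner_commute[of p' a'] inner_commute[of p' b'])
    then have "(x' + \<alpha>') * (1 - a' \<bullet> p') + B * (b' \<bullet> p' - c) + w' * (a' \<bullet> q' - p' \<bullet> q') = 0"
      by (simp add: algebra_simps)
    moreover have "0 \<le> (x' + \<alpha>') * (1 - a' \<bullet> p')" using pos S2_inner_le_1[OF S'(3,1)] by simp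
    moreover have "0 \<le> B * (b' \<bullet> p' - c)" using pos pq' by (intro mult_nonneg_nonneg) (auto simp: B_def)
    moreover have "0 < w' * (a' \<bullet> q' - p' \<bullet> q')" using pos pq' less by simp
    ultimately show False by linarith
  qed
  \<comment> \<open>Here \<open>p'\<close> lies in the spherical triangle with corners
    \<open>a\<close>, \<open>b\<close> and \<open>q'\<close>, each of which has inner product at
    least \<open>c\<close> with \<open>q'\<close>.\<close>
  have cone: "c \<le> p' \<bullet> q'"
    if S': "p' \<in> S2" "q' \<in> S2" and pq': "c \<le> a \<bullet> q'" "c \<le> b \<bullet> q'"
      and pos: "x' > 0" "w' > 0" "\<alpha>' \<ge> 0" "\<beta>' \<ge> 0"
      and eq': "x' *\<^sub>R p' - w' *\<^sub>R q' = \<alpha>' *\<^sub>R a + \<beta>' *\<^sub>R b"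
    for p' q' :: point and x' w' \<alpha>' \<beta>' :: real
  proof -
    have e: "x' *\<^sub>R p' = \<alpha>' *\<^sub>R a + \<beta>' *\<^sub>R b + w' *\<^sub>R q'" using eq' by (simp add: algebra_simps)
    have "x' = norm (x' *\<^sub>R p')" using S' pos by simp
    also have "\<dots> \<le> \<alpha>' + \<beta>' + w'"
      using norm_triangle_ineq[of "\<alpha>' *\<^sub>R a + \<beta>' *\<^sub>R b" "w' *\<^sub>R q'"]
        norm_triangle_ineq[of "\<alpha>' *\<^sub>R a" "\<beta>' *\<^sub>R b"] pos S S' by (simp add: e)
    finally have "c * x' \<le> c * (\<alpha>' + \<beta>' + w')" using c by simp
    also have "\<dots> \<le> \<alpha>' * (a \<bullet> q') + \<beta>' * (b \<bullet> q') + w'"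
    proof -
      have "\<alpha>' * c \<le> \<alpha>' * (a \<bullet> q')" "\<beta>' * c \<le> \<beta>' * (b \<bullet> q')" "w' * c \<le> w' * 1"
        using mult_left_mono[OF pq'(1) pos(3)] mult_left_mono[OF pq'(2) pos(4)] pos(2) c by simp_all
      then show ?thesis by (simp add: algebra_simps)
    qed
    also have "\<dots> = x' * (p' \<bullet> q')"
      using arg_cong[OF e, of "\<lambda>v. v \<bullet> q'"] S2_inner_self[OF S'(2)] by (simp add: inner_add_left)
    finally show ?thesis using pos by (simp add: mult.commute)
  qed
  have eq2: "w *\<^sub>R q - x *\<^sub>R p = (- \<alpha>) *\<^sub>R a + (- \<beta>) *\<^sub>R b" using eq by (simp add: algebra_simps)
  have eq3: "x *\<^sub>R p - w *\<^sub>R q = \<beta> *\<^sub>R b + \<alpha> *\<^sub>R a" using eq by (simp add: algebra_simps)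
  consider "\<alpha> \<ge> 0" "\<beta> \<ge> 0" | "\<alpha> \<le> 0" "\<beta> \<le> 0" | "\<alpha> \<ge> 0" "\<beta> \<le> 0" | "\<alpha> \<le> 0" "\<beta> \<ge> 0" by linarith
  then show ?thesis
  proof cases
    case 1
    then show ?thesis using cone[OF S(3,4) q(2,3) xw _ _ eq] by blast
  next
    case 2
    then show ?thesis using cone[OF S(4,3) p(2,3) xw(2,1) _ _ eq2] by (simp add: inner_commute)
  next
    case 3
    then show ?thesis using crossing[OF S(3,4,1,2) ab p(3) q(2) xw _ _ eq] by blast
  next
    case 4
    then show ?thesis using crossing[OF S(3,4,2,1) _ p(2) q(3) xw _ _ eq3] ab by (simp add: inner_commute)
  qed
qed

text \<open>The two equations leave a line in the direction \<open>cross3 x x'\<close>, which meets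
  the sphere only in \<open>v0\<close> and in its mirror image in the plane of \<open>x\<close> and
  \<open>x'\<close>.\<close>

lemma finite_circles_Int:
  assumes "x \<in> S2" "x' \<in> S2" "\<bar>x \<bullet> x'\<bar> < 1"
  shows "finite {v \<in> S2. x \<bullet> v = c \<and> x' \<bullet> v = d}"
proof (cases "{v \<in> S2. x \<bullet> v = c \<and> x' \<bullet> v = d} = {}")
  case False
  then obtain v0 where v0: "v0 \<in> S2" "x \<bullet> v0 = c" "x' \<bullet> v0 = d" by blast
  define n where "n = cross3 x x'"
  have n: "n \<noteq> 0" unfolding n_def by (rule cross3_neq_0[OF assms])
  have "v \<in> {v0, v0 - (2 * (n \<bullet> v0) / (n \<bullet> n)) *\<^sub>R n}"
    if v: "v \<in> S2" "x \<bullet> v = c" "x' \<bullet> v = d" for v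
  proof -
    define t where "t = n \<bullet> (v - v0) / (n \<bullet> n)"
    have "v - v0 - t *\<^sub>R n = 0"
    proof (rule orthogonal_basis_zero[of x _ x'])
      show "cross3 x x' \<bullet> (v - v0 - t *\<^sub>R n) = 0"
        using n by (simp add: n_def[symmetric] inner_diff_right t_def)
    qed (use v v0 n in \<open>auto simp: inner_diff_right n_def dot_cross_self\<close>)
    then have vt: "v = v0 + t *\<^sub>R n" by (simp add: algebra_simps)
    have "v \<bullet> v = 1" "v0 \<bullet> v0 = 1" using v v0 S2_inner_self by auto
    then have "t * (2 * (n \<bullet> v0) + t * (n \<bullet> n)) = 0"
      unfolding vt by (simp add: inner_add_left inner_add_right inner_commute algebra_simps)
    then consider "t = 0" | "t * (n \<bullet> n) = - (2 * (n \<bullet> v0))"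
      by (auto simp: add_eq_0_iff)
    then consider "t = 0" | "t = - (2 * (n \<bullet> v0) / (n \<bullet> n))"
      using n by (metis inner_eq_zero_iff minus_divide_left nonzero_eq_divide_eq)
    then show ?thesis by cases (auto simp: vt)
  qed
  then have "{v \<in> S2. x \<bullet> v = c \<and> x' \<bullet> v = d} \<subseteq> {v0, v0 - (2 * (n \<bullet> v0) / (n \<bullet> n)) *\<^sub>R n}"
    by blast
  then show ?thesis by (rule finite_subset) simp
qed (metis finite.emptyI)

text \<open>A point at distance \<open>arccos c\<close> from \<open>g\<close> is given by its direction \<open>u\<close> as seen from \<open>g\<close>; the
  coefficient \<open>sqrt (1 - c\<^sup>2)\<close> is the sine of that distance.\<close>

definition directions :: "real \<Rightarrow> point set \<Rightarrow> point \<Rightarrow> point set" where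
  "directions c X g =
     {u \<in> S2. g \<bullet> u = 0 \<and> c *\<^sub>R g + sqrt (1 - c\<^sup>2) *\<^sub>R u \<in> caps c X}"

section \<open>The arc that the discs about \<open>X\<close> cut out of a circle about
  \<open>g\<close>\<close>

lemma circle_point_in_S2:
  assumes "g \<in> S2" "u \<in> S2" "g \<bullet> u = 0" "\<alpha>\<^sup>2 + \<beta>\<^sup>2 = 1"
  shows "\<alpha> *\<^sub>R g + \<beta> *\<^sub>R u \<in> S2"
proof (rule S2_I)
  show "(\<alpha> *\<^sub>R g + \<beta> *\<^sub>R u) \<bullet> (\<alpha> *\<^sub>R g + \<beta> *\<^sub>R u) = 1"
    using assms S2_inner_self[OF assms(1)] S2_inner_self[OF assms(2)]
    by (simp add: inner_add_left inner_add_right inner_commute[of u g] power2_eq_square)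
qed

lemma circle_direction:
  assumes "g \<in> S2" "p \<in> S2" "g \<bullet> p = c" "0 < c" "c < 1"
  obtains u where "u \<in> S2" "g \<bullet> u = 0" "p = c *\<^sub>R g + sqrt (1 - c\<^sup>2) *\<^sub>R u"
proof -
  define s where "s = sqrt (1 - c\<^sup>2)"
  have s: "s > 0" "s\<^sup>2 = 1 - c\<^sup>2" using assms by (auto simp: s_def power_less_one_iff power_le_one)
  define u where "u = inverse s *\<^sub>R (p - c *\<^sub>R g)"
  have I: "g \<bullet> g = 1" "p \<bullet> p = 1" "p \<bullet> g = c" using assms S2_inner_self by (auto simp: inner_commute)
  have "(p - c *\<^sub>R g) \<bullet> (p - c *\<^sub>R g) = s\<^sup>2"
    using I assms(3) s(2) by (simp add: inner_diff_left inner_diff_right power2_eq_square)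
  moreover have "u \<bullet> u = inverse s * (inverse s * ((p - c *\<^sub>R g) \<bullet> (p - c *\<^sub>R g)))"
    by (simp only: u_def inner_scaleR_left inner_scaleR_right)
  ultimately have "u \<bullet> u = 1" using s(1) by (simp add: power2_eq_square field_simps)
  then have "u \<in> S2" by (rule S2_I)
  moreover have "g \<bullet> u = 0" using I assms(3) by (simp add: u_def inner_diff_right)
  moreover have "p = c *\<^sub>R g + s *\<^sub>R u" using s(1) by (simp add: u_def)
  ultimately show ?thesis using that by (simp add: s_def)
qed

lemma directions_iff:
  assumes "g \<in> S2" "0 < c" "c < 1"
  shows "u \<in> directions c X g \<longleftrightarrow>
    u \<in> S2 \<and> g \<bullet> u = 0 \<and> (\<forall>x\<in>X. c \<le> c * (x \<bullet> g) + sqrt (1 - c\<^sup>2) * (x \<bullet> u))"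
proof -
  have "(sqrt (1 - c\<^sup>2))\<^sup>2 = 1 - c\<^sup>2" using assms by (simp add: power_le_one)
  then have "c *\<^sub>R g + sqrt (1 - c\<^sup>2) *\<^sub>R u \<in> S2" if "u \<in> S2" "g \<bullet> u = 0"
    using circle_point_in_S2[OF assms(1) that, of c "sqrt (1 - c\<^sup>2)"] by simp
  then show ?thesis by (auto simp: directions_def caps_def inner_add_right)
qed

lemma closed_directions:
  assumes "g \<in> S2" "0 < c" "c < 1"
  shows "closed (directions c X g)"
proof -
  have "directions c X g = S2 \<inter> {u. g \<bullet> u = 0} \<inter>
      (\<Inter>x\<in>X. {u. c \<le> c * (x \<bullet> g) + sqrt (1 - c\<^sup>2) * (x \<bullet> u)})"
    using directions_iff[OF assms] by auto
  moreover have "closed \<dots>"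
    by (intro closed_Int closed_INT ballI closed_Collect_le closed_Collect_eq continuous_intros closed_sphere)
  ultimately show ?thesis by simp
qed

text \<open>A second centre \<open>h\<close> leaves less than a half circle about \<open>g\<close>:
  as \<open>h \<bullet> g < 1\<close>, the component along \<open>g\<close> falls short of
  \<open>c\<close>, and \<open>u\<close> has to make up for it.\<close>

lemma directions_inner_pos:
  assumes X: "X \<subseteq> S2" and c: "0 < c" "c < 1" and gh: "g \<in> S2" "h \<in> X" "h \<noteq> g"
    and u: "u \<in> directions c X g"
  shows "0 < h \<bullet> u"
proof -
  have "h \<bullet> g < 1" using S2_inner_less_1 gh X by blast
  then have "c * (h \<bullet> g) < c" using c by simp
  moreover have "c \<le> c * (h \<bullet> g) + sqrt (1 - c\<^sup>2) * (h \<bullet> u)"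
    using u gh(2) by (simp add: directions_iff[OF gh(1) c])
  ultimately have "0 < sqrt (1 - c\<^sup>2) * (h \<bullet> u)" by linarith
  moreover have "0 < sqrt (1 - c\<^sup>2)" using c by (simp add: power_less_one_iff)
  ultimately show ?thesis by (simp only: zero_less_mult_pos)
qed

text \<open>The constraint of \<open>x\<close> on a direction \<open>u\<close> reads
  \<open>k \<le> s * (x \<bullet> u)\<close> with \<open>k = c - c * (x \<bullet> g)\<close>. As
  \<open>k\<close> is nonnegative, this survives a convex combination followed by division by a norm
  of at most 1.\<close>

lemma directions_convex:
  assumes X: "X \<subseteq> S2" and c: "0 < c" "c < 1" and gh: "g \<in> S2" "h \<in> X" "h \<noteq> g"
    and uv: "u \<in> directions c X g" "v \<in> directions c X g"
  shows "great_arc u v \<subseteq> directions c X g"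
proof
  fix y assume "y \<in> great_arc u v"
  then obtain r where r: "0 \<le> r" "r \<le> 1" "y = sgn ((1 - r) *\<^sub>R u + r *\<^sub>R v)" by (rule great_arcE)
  define s where "s = sqrt (1 - c\<^sup>2)"
  have s: "s > 0" using c by (auto simp: s_def power_less_one_iff)
  define m where "m = (1 - r) *\<^sub>R u + r *\<^sub>R v"
  have hu: "0 < h \<bullet> u" "0 < h \<bullet> v" using directions_inner_pos[OF X c gh] uv by auto
  have "0 < h \<bullet> m"
  proof (cases "r = 0")
    case False
    then have "0 < r * (h \<bullet> v)" "0 \<le> (1 - r) * (h \<bullet> u)" using r hu by auto
    then show ?thesis by (simp add: m_def inner_add_right)
  qed (use hu in \<open>simp add: m_def\<close>)
  then have nz: "m \<noteq> 0" by auto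
  have u: "u \<in> S2" "g \<bullet> u = 0" "\<And>x. x \<in> X \<Longrightarrow> c \<le> c * (x \<bullet> g) + s * (x \<bullet> u)"
    and v: "v \<in> S2" "g \<bullet> v = 0" "\<And>x. x \<in> X \<Longrightarrow> c \<le> c * (x \<bullet> g) + s * (x \<bullet> v)"
    using uv by (auto simp: directions_iff[OF gh(1) c] s_def)
  have n1: "norm m \<le> 1"
    using norm_triangle_ineq[of "(1 - r) *\<^sub>R u" "r *\<^sub>R v"] r u v by (simp add: m_def)
  have "c \<le> c * (x \<bullet> g) + s * (x \<bullet> sgn m)" if x: "x \<in> X" for x
  proof -
    define k where "k = c - c * (x \<bullet> g)"
    have "x \<bullet> g \<le> 1" using S2_inner_le_1 x X gh by blast
    then have "c * (x \<bullet> g) \<le> c" using c by simp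
    then have k: "0 \<le> k" by (simp add: k_def)
    have "(1 - r) * k \<le> (1 - r) * (s * (x \<bullet> u))" "r * k \<le> r * (s * (x \<bullet> v))"
      using u(3)[OF x] v(3)[OF x] r by (intro mult_left_mono; simp add: k_def)+
    then have "k \<le> s * (x \<bullet> m)" by (simp add: m_def inner_add_right algebra_simps)
    moreover have "k * norm m \<le> k * 1" using n1 k by (rule mult_left_mono)
    ultimately have "k \<le> s * (x \<bullet> m) / norm m" using nz by (simp add: pos_le_divide_eq)
    then show ?thesis by (simp add: k_def inner_sgn_right)
  qed
  moreover have "g \<bullet> sgn m = 0" using u v by (simp add: m_def inner_sgn_right inner_add_right)
  ultimately show "y \<in> directions c X g"
    unfolding r(3) m_def[symmetric] directions_iff[OF gh(1) c] using sgn_in_S2[OF nz] by (simp add: s_def)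
qed

lemma directions_great_arc:
  assumes X: "X \<subseteq> S2" and c: "0 < c" "c < 1" and gh: "g \<in> S2" "h \<in> X" "h \<noteq> g"
    and ne: "directions c X g \<noteq> {}"
  obtains P Q where "P \<in> directions c X g" "Q \<in> directions c X g" "directions c X g = great_arc P Q"
proof (rule circle_convex_eq_great_arc[of "directions c X g" g h])
  show "directions c X g \<subseteq> S2" by (auto simp: directions_def)
  show "g \<bullet> u = 0" if "u \<in> directions c X g" for u using that by (simp add: directions_def)
qed (use that ne gh directions_inner_pos[OF X c gh] closed_directions[OF gh(1) c]
      directions_convex[OF X c gh] in auto)

text \<open>If all constraints of centres other than \<open>g\<close> were slack at
  \<open>P\<close>, it could be moved along the circle in both directions, which an endpoint does
  not allow. The case \<open>P = Q\<close> is included: it identifies a one-point edge as a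
  corner.\<close>

lemma directions_endpoint_active:
  assumes "finite X" and X: "X \<subseteq> S2" and c: "0 < c" "c < 1" and g: "g \<in> S2"
    and arc: "directions c X g = great_arc P Q" "P \<in> directions c X g"
  obtains h where "h \<in> X" "h \<noteq> g" "h \<bullet> (c *\<^sub>R g + sqrt (1 - c\<^sup>2) *\<^sub>R P) = c"
proof (rule ccontr)
  assume "\<not> thesis"
  then have no: "\<And>h. h \<in> X \<Longrightarrow> h \<noteq> g \<Longrightarrow> c * (h \<bullet> g) + sqrt (1 - c\<^sup>2) * (h \<bullet> P) \<noteq> c"
    using that by (auto simp: inner_add_right)
  have P: "P \<in> S2" "g \<bullet> P = 0" "\<And>x. x \<in> X \<Longrightarrow> c \<le> c * (x \<bullet> g) + sqrt (1 - c\<^sup>2) * (x \<bullet> P)"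
    using arc(2) by (auto simp: directions_iff[OF g c])
  define w where "w = cross3 g P"
  have w: "w \<noteq> 0" "P \<bullet> w = 0" "g \<bullet> w = 0"
    using cross3_neq_0[OF g P(1)] P(2) by (auto simp: w_def dot_cross_self)
  have ev: "\<forall>\<^sub>F t in at_right 0. sgn (P + t *\<^sub>R v) \<in> directions c X g" if v: "g \<bullet> v = 0" for v
  proof -
    have "\<forall>\<^sub>F t in at_right 0. \<forall>x\<in>X. c \<le> c * (x \<bullet> g) + sqrt (1 - c\<^sup>2) * (x \<bullet> sgn (P + t *\<^sub>R v))"
    proof (rule eventually_ball_finite[OF assms(1)], rule ballI)
      fix x assume x: "x \<in> X"
      show "\<forall>\<^sub>F t in at_right 0. c \<le> c * (x \<bullet> g) + sqrt (1 - c\<^sup>2) * (x \<bullet> sgn (P + t *\<^sub>R v))"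
      proof (cases "x = g")
        case True
        then show ?thesis using S2_inner_self[OF g] P(2) v
          by (simp add: inner_sgn_right inner_add_right)
      next
        case False
        have "((\<lambda>t. c * (x \<bullet> g) + sqrt (1 - c\<^sup>2) * (x \<bullet> sgn (P + t *\<^sub>R v)))
            \<longlongrightarrow> c * (x \<bullet> g) + sqrt (1 - c\<^sup>2) * (x \<bullet> P)) (at_right 0)"
          by (intro tendsto_intros inner_sgn_perturb_tendsto P)
        moreover have "c < c * (x \<bullet> g) + sqrt (1 - c\<^sup>2) * (x \<bullet> P)"
          using P(3)[OF x] no[OF x False] by simp
        ultimately show ?thesis by (rule eventually_mono[OF order_tendstoD(1)]) simp
      qed
    qed
    with eventually_perturb_nonzero[OF P(1), of v] show ?thesis
    proof eventually_elim
      case (elim t)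
      have "g \<bullet> sgn (P + t *\<^sub>R v) = 0" using P(2) v by (simp add: inner_sgn_right inner_add_right)
      then show ?case using elim sgn_in_S2[OF elim(1)] by (simp add: directions_iff[OF g c] del: mem_sphere_0)
    qed
  qed
  have "\<forall>\<^sub>F t in at_right 0. sgn (P + t *\<^sub>R w) \<in> directions c X g \<and> sgn (P + t *\<^sub>R - w) \<in> directions c X g"
    using w by (intro eventually_conj ev) auto
  then obtain t where "t > 0" "sgn (P + t *\<^sub>R w) \<in> great_arc P Q" "sgn (P - t *\<^sub>R w) \<in> great_arc P Q"
    by (rule ex_eventually_at_right_0) (auto simp: arc(1))
  then show False using great_arc_endpoint_extremal P(1) w by blast
qed

lemma great_arc_commute: "great_arc P Q = great_arc Q P"
  by (simp add: great_arc_def closed_segment_commute)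

lemma great_arc_cone:
  fixes P Q :: point
  assumes "u \<in> great_arc P Q"
  obtains \<alpha> \<beta> where "0 \<le> \<alpha>" "0 \<le> \<beta>" "u = \<alpha> *\<^sub>R P + \<beta> *\<^sub>R Q"
proof -
  obtain r where r: "0 \<le> r" "r \<le> 1" "u = sgn ((1 - r) *\<^sub>R P + r *\<^sub>R Q)" using assms by (rule great_arcE)
  define k where "k = inverse (norm ((1 - r) *\<^sub>R P + r *\<^sub>R Q))"
  have "u = (k * (1 - r)) *\<^sub>R P + (k * r) *\<^sub>R Q"
    unfolding r(3) sgn_div_norm k_def[symmetric] by (simp add: scaleR_add_right)
  moreover have "0 \<le> k * (1 - r)" "0 \<le> k * r" using r by (auto simp: k_def)
  ultimately show ?thesis using that by blast
qed

text \<open>\<open>P'\<close> lies in the cone between \<open>u\<close> and \<open>P\<close>, so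
  \<open>u\<close> remains in the cone of \<open>P'\<close> and \<open>Q\<close>. Eliminating
  \<open>P\<close>, which takes \<open>0 < \<delta>\<close>, leaves the multiple
  \<open>k *\<^sub>R u\<close> on the left.\<close>

lemma cone_shrink:
  fixes u :: point
  assumes "u = \<alpha> *\<^sub>R P + \<beta> *\<^sub>R Q" "0 \<le> \<alpha>" "0 \<le> \<beta>" "P' = \<gamma> *\<^sub>R u + \<delta> *\<^sub>R P" "0 \<le> \<gamma>" "0 < \<delta>"
  obtains \<alpha>' \<beta>' where "u = \<alpha>' *\<^sub>R P' + \<beta>' *\<^sub>R Q" "0 \<le> \<alpha>'" "0 \<le> \<beta>'"
proof -
  define k where "k = 1 + \<alpha> * \<gamma> / \<delta>"
  have k: "k > 0" unfolding k_def using assms by (intro add_pos_nonneg) auto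
  have "k *\<^sub>R u = (\<alpha> / \<delta>) *\<^sub>R P' + \<beta> *\<^sub>R Q"
    using assms(6) by (simp add: k_def assms(4) scaleR_add_left scaleR_add_right)
      (metis add.commute add.left_commute assms(1))
  then have "inverse k *\<^sub>R (k *\<^sub>R u) = inverse k *\<^sub>R ((\<alpha> / \<delta>) *\<^sub>R P' + \<beta> *\<^sub>R Q)" by simp
  then have "u = (inverse k * (\<alpha> / \<delta>)) *\<^sub>R P' + (inverse k * \<beta>) *\<^sub>R Q"
    using k by (simp add: scaleR_add_right)
  then show ?thesis using that k assms by (metis divide_nonneg_pos inverse_nonnegative_iff_nonnegative less_imp_le mult_nonneg_nonneg)
qed

locale diametral_set =
  fixes c :: real and X :: "point set" and a b :: point
  assumes c: "0 < c" "c < 1"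
    and fin: "finite X" and X: "X \<subseteq> S2" and diam: "X \<subseteq> caps c X"
    and ab: "a \<in> X" "b \<in> X" "a \<bullet> b = c"
begin

definition side :: "point \<Rightarrow> real" where
  "side p = cross3 a b \<bullet> p"

definition vertices :: "point set" where
  "vertices = {v \<in> caps c X. 0 \<le> side v \<and> (\<exists>x\<in>X. \<exists>x'\<in>X. x \<noteq> x' \<and> x \<bullet> v = c \<and> x' \<bullet> v = c)}"

lemma ab_S2: "a \<in> S2" "b \<in> S2"
  using ab X by auto

lemma X_inner: "x \<in> X \<Longrightarrow> x' \<in> X \<Longrightarrow> x \<noteq> x' \<Longrightarrow> \<bar>x \<bullet> x'\<bar> < 1"
proof -
  assume x: "x \<in> X" "x' \<in> X" "x \<noteq> x'"
  then have "x \<bullet> x' < 1" using S2_inner_less_1 X by blast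
  moreover have "c \<le> x \<bullet> x'" using diam x capsD by blast
  ultimately show ?thesis using c by simp
qed

lemma finite_vertices: "finite vertices"
proof -
  have "vertices \<subseteq> (\<Union>x\<in>X. \<Union>x'\<in>X - {x}. {v \<in> S2. x \<bullet> v = c \<and> x' \<bullet> v = c})"
    by (auto simp: vertices_def caps_def)
  moreover have "finite \<dots>"
    using fin X X_inner by (intro finite_UN_I finite_Diff finite_circles_Int) auto
  ultimately show ?thesis by (rule finite_subset)
qed

lemma on_chord_ge:
  assumes p: "p \<in> caps c X" "side p = 0" and y: "y \<in> caps c X"
  shows "c \<le> y \<bullet> p"
  using chord_inner_ge[OF ab_S2 caps_in_S2[OF p(1)] ab(3) c, of y] p(2)
    capsD[OF p(1) ab(1)] capsD[OF p(1) ab(2)] capsD[OF y ab(1)] capsD[OF y ab(2)]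
  by (simp add: side_def)

lemma same_side_ge:
  assumes p: "p \<in> caps c X" "0 \<le> side p" and q: "q \<in> caps c X" "0 \<le> side q"
  shows "c \<le> p \<bullet> q"
  using half_lens_diameter[OF ab_S2 caps_in_S2[OF p(1)] caps_in_S2[OF q(1)] ab(3) c] p(2) q(2)
    capsD[OF p(1) ab(1)] capsD[OF p(1) ab(2)] capsD[OF q(1) ab(1)] capsD[OF q(1) ab(2)]
  by (simp add: side_def)

lemma other_side_ge:
  assumes p: "p \<in> caps c X" "side p \<le> 0" and q: "q \<in> caps c X" "side q \<le> 0"
  shows "c \<le> p \<bullet> q"
proof -
  have "cross3 b a = - cross3 a b" by (rule cross_skew)
  then show ?thesis
    using half_lens_diameter[OF ab_S2(2,1) caps_in_S2[OF p(1)] caps_in_S2[OF q(1)] _ c] p(2) q(2) ab(3)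
      capsD[OF p(1) ab(1)] capsD[OF p(1) ab(2)] capsD[OF q(1) ab(1)] capsD[OF q(1) ab(2)]
    by (simp add: side_def inner_commute)
qed

text \<open>The ends of the arc about \<open>g\<close> through \<open>p\<close> are vertices; an end on the wrong side of \<open>ab\<close> is
  replaced by the point where the arc crosses \<open>ab\<close>. If \<open>y\<close> is within \<open>arccos c\<close> of \<open>g\<close> and of
  both ends, then it is so for the whole arc.\<close>

lemma arc_point_ge:
  assumes y: "y \<in> caps c X" "\<And>v. v \<in> vertices \<Longrightarrow> c \<le> y \<bullet> v"
    and p: "p \<in> caps c X" "0 \<le> side p" and g: "g \<in> X" "g \<bullet> p = c"
  shows "c \<le> y \<bullet> p"
proof -
  define s where "s = sqrt (1 - c\<^sup>2)"
  have s: "s > 0" using c by (simp add: s_def power_less_one_iff)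
  have gS: "g \<in> S2" using g X by blast
  have yS: "y \<in> S2" using y caps_in_S2 by blast
  have "a \<noteq> b" using ab c S2_inner_self[OF ab_S2(1)] by auto
  then obtain h where h: "h \<in> X" "h \<noteq> g" using ab by metis
  define U where "U = directions c X g"
  obtain u0 where u0: "u0 \<in> S2" "g \<bullet> u0 = 0" "p = c *\<^sub>R g + s *\<^sub>R u0"
    using circle_direction[OF gS caps_in_S2[OF p(1)] g(2) c] by (metis s_def)
  have u0U: "u0 \<in> U" using u0 p(1) by (simp add: U_def directions_def s_def)
  have U: "u \<in> S2" "c *\<^sub>R g + s *\<^sub>R u \<in> caps c X" if "u \<in> U" for u
    using that by (auto simp: U_def directions_def s_def)
  have hpos: "0 < h \<bullet> u" if "u \<in> U" for u
    using directions_inner_pos[OF X c gS h] that by (simp add: U_def)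
  have conv: "great_arc u v \<subseteq> U" if "u \<in> U" "v \<in> U" for u v
    using directions_convex[OF X c gS h] that by (simp add: U_def)
  obtain P Q where PQ: "P \<in> U" "Q \<in> U" "U = great_arc P Q"
    using directions_great_arc[OF X c gS h] u0U unfolding U_def by blast
  \<comment> \<open>Seen from \<open>g\<close>, the arc point of direction \<open>u\<close> is
    within \<open>arccos c\<close> of \<open>y\<close> iff \<open>k \<le> y \<bullet> u\<close>.
    Nonnegativity of \<open>k\<close> lets this bound pass to unit vectors in a cone.\<close>
  define k where "k = (c - c * (y \<bullet> g)) / s"
  have k: "0 \<le> k" using c s S2_inner_le_1[OF yS gS] by (simp add: k_def)
  have k_iff: "c \<le> y \<bullet> (c *\<^sub>R g + s *\<^sub>R u) \<longleftrightarrow> k \<le> y \<bullet> u" for u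
    using s by (simp add: k_def inner_add_right pos_divide_le_eq algebra_simps)
  show ?thesis
  proof (cases "side p = 0")
    case True
    then show ?thesis using on_chord_ge p y by blast
  next
    case False
    \<comment> \<open>The strict \<open>0 < \<delta>\<close> is for \<open>cone_shrink\<close>. It
      is available because \<open>side p > 0\<close>: an arc from \<open>u0\<close> that changes
      side crosses \<open>ab\<close> only after leaving \<open>u0\<close>.\<close>
    have cut: "\<exists>E'\<in>U. k \<le> y \<bullet> E' \<and> (\<exists>\<gamma> \<delta>. E' = \<gamma> *\<^sub>R u0 + \<delta> *\<^sub>R E \<and> 0 \<le> \<gamma> \<and> 0 < \<delta>)"
      if E: "E \<in> U" and ex: "\<exists>h\<in>X. h \<noteq> g \<and> h \<bullet> (c *\<^sub>R g + s *\<^sub>R E) = c" for E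
    proof (cases "0 \<le> side (c *\<^sub>R g + s *\<^sub>R E)")
      case True
      have "g \<bullet> (c *\<^sub>R g + s *\<^sub>R E) = c"
        using E S2_inner_self[OF gS] by (simp add: U_def directions_def inner_add_right)
      then have "c *\<^sub>R g + s *\<^sub>R E \<in> vertices"
        unfolding vertices_def using True ex g(1) U(2)[OF E] by blast
      then have "k \<le> y \<bullet> E" using y(2) k_iff by blast
      then show ?thesis using E by (intro bexI[of _ E] conjI exI[of _ 0] exI[of _ 1]) auto
    next
      case neg: False
      define m where "m r = (1 - r) *\<^sub>R u0 + r *\<^sub>R E" for r
      define f where "f r = side (c *\<^sub>R g + s *\<^sub>R sgn (m r))" for r
      have nz: "m r \<noteq> 0" if "0 \<le> r" "r \<le> 1" for r
      proof -
        have "0 < h \<bullet> m r"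
        proof (cases "r = 0")
          case False
          then have "0 < r * (h \<bullet> E)" "0 \<le> (1 - r) * (h \<bullet> u0)"
            using that hpos[OF E] hpos[OF u0U] by auto
          then show ?thesis by (simp add: m_def inner_add_right)
        qed (use hpos[OF u0U] in \<open>simp add: m_def\<close>)
        then show ?thesis by auto
      qed
      have "continuous_on {0..1} f" unfolding f_def side_def
        by (intro continuous_intros) (use nz in \<open>auto simp: m_def intro!: continuous_intros\<close>)
      moreover have "0 \<le> f 0" using p(2) u0 sgn_S2[OF u0(1)] by (simp add: f_def m_def)
      moreover have "f 1 \<le> 0" using neg sgn_S2[OF U(1)[OF E]] by (simp add: f_def m_def)
      ultimately obtain r where r: "0 \<le> r" "r \<le> 1" "f r = 0"
        using IVT2'[of f 1 0 0] by auto
      have "r \<noteq> 0"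
        using r(3) False u0 sgn_S2[OF u0(1)] by (auto simp: f_def m_def)
      then have r0: "0 < r" using r by simp
      define E' where "E' = sgn (m r)"
      have "E' \<in> great_arc u0 E"
        unfolding E'_def m_def using r nz[OF r(1,2)] by (intro great_arc_conic) (auto simp: m_def)
      then have E'U: "E' \<in> U" using conv[OF u0U E] by blast
      then have "c \<le> y \<bullet> (c *\<^sub>R g + s *\<^sub>R E')"
        using on_chord_ge[OF U(2)[OF E'U] _ y(1)] r(3) by (simp add: f_def E'_def)
      then have "k \<le> y \<bullet> E'" by (simp add: k_iff)
      moreover have "E' = (inverse (norm (m r)) * (1 - r)) *\<^sub>R u0 + (inverse (norm (m r)) * r) *\<^sub>R E"
        by (simp add: E'_def sgn_div_norm m_def scaleR_add_right)
      moreover have "0 \<le> inverse (norm (m r)) * (1 - r)" "0 < inverse (norm (m r)) * r"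
        using r r0 nz[OF r(1,2)] by auto
      ultimately show ?thesis using E'U by blast
    qed
    have "\<exists>h\<in>X. h \<noteq> g \<and> h \<bullet> (c *\<^sub>R g + s *\<^sub>R P) = c"
      using directions_endpoint_active[OF fin X c gS, of P Q] PQ unfolding U_def s_def by metis
    then obtain P' \<gamma> \<delta> where P': "P' \<in> U" "k \<le> y \<bullet> P'" "P' = \<gamma> *\<^sub>R u0 + \<delta> *\<^sub>R P" "0 \<le> \<gamma>" "0 < \<delta>"
      using cut[OF PQ(1)] by blast
    have "\<exists>h\<in>X. h \<noteq> g \<and> h \<bullet> (c *\<^sub>R g + s *\<^sub>R Q) = c"
      using directions_endpoint_active[OF fin X c gS, of Q P] PQ great_arc_commute[of P Q]
      unfolding U_def s_def by metis
    then obtain Q' \<gamma>' \<delta>' where Q': "Q' \<in> U" "k \<le> y \<bullet> Q'" "Q' = \<gamma>' *\<^sub>R u0 + \<delta>' *\<^sub>R Q" "0 \<le> \<gamma>'" "0 < \<delta>'"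
      using cut[OF PQ(2)] by blast
    obtain \<alpha> \<beta> where "u0 = \<alpha> *\<^sub>R P + \<beta> *\<^sub>R Q" "0 \<le> \<alpha>" "0 \<le> \<beta>"
      using great_arc_cone[of u0 P Q] u0U PQ(3) by blast
    then obtain \<alpha>' \<beta>' where 1: "u0 = \<alpha>' *\<^sub>R P' + \<beta>' *\<^sub>R Q" "0 \<le> \<alpha>'" "0 \<le> \<beta>'"
      using cone_shrink[OF _ _ _ P'(3-5)] by blast
    then have "u0 = \<beta>' *\<^sub>R Q + \<alpha>' *\<^sub>R P'" by (simp add: add.commute)
    then obtain \<alpha>'' \<beta>'' where "u0 = \<alpha>'' *\<^sub>R Q' + \<beta>'' *\<^sub>R P'" "0 \<le> \<alpha>''" "0 \<le> \<beta>''"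
      using cone_shrink[OF _ 1(3,2) Q'(3-5)] by blast
    then have "k \<le> y \<bullet> u0"
      using conic_inner_ge[OF u0(1) U(1)[OF Q'(1)] U(1)[OF P'(1)] _ _ _ k Q'(2) P'(2)] by blast
    then show ?thesis using k_iff u0(3) by simp
  qed
qed

text \<open>Consider a point of the closed half that is farthest from \<open>y\<close>. If it were
  too far, it would lie on no bounding circle by \<open>arc_point_ge\<close> and not on
  \<open>ab\<close> by \<open>on_chord_ge\<close>; being interior to the half, it could be moved
  still farther from \<open>y\<close>.\<close>

lemma opposite_side_ge:
  assumes y: "y \<in> caps c X" "\<And>v. v \<in> vertices \<Longrightarrow> c \<le> y \<bullet> v"
    and p: "p \<in> caps c X" "0 \<le> side p"
  shows "c \<le> y \<bullet> p"
proof (rule ccontr)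
  assume less: "\<not> c \<le> y \<bullet> p"
  define L where "L = caps c X \<inter> {p. 0 \<le> side p}"
  have "closed {p. 0 \<le> side p}" unfolding side_def
    by (intro closed_Collect_le continuous_intros)
  then have "compact L" unfolding L_def by (intro compact_Int_closed compact_caps)
  moreover have "L \<noteq> {}" using p by (auto simp: L_def)
  moreover have "continuous_on L (\<lambda>p. y \<bullet> p)" by (intro continuous_intros)
  ultimately obtain p0 where p0: "p0 \<in> L" "\<And>q. q \<in> L \<Longrightarrow> y \<bullet> p0 \<le> y \<bullet> q"
    using continuous_attains_inf[of L "\<lambda>p. y \<bullet> p"] by blast
  have lt: "y \<bullet> p0 < c" using p0(2)[of p] p less by (simp add: L_def)
  have p0c: "p0 \<in> caps c X" "0 \<le> side p0" using p0 by (auto simp: L_def)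
  have S: "y \<in> S2" "p0 \<in> S2" using y p0c caps_in_S2 by auto
  have strict: "c < x \<bullet> p0" if "x \<in> X" for x
    using arc_point_ge[OF y p0c that] lt capsD[OF p0c(1) that] by force
  have sp: "0 < side p0" using on_chord_ge[OF p0c(1) _ y(1)] lt p0c(2) by force
  have "y \<noteq> - p0" using capsD[OF y(1) ab(1)] capsD[OF p0c(1) ab(1)] c by auto
  then have abs: "\<bar>y \<bullet> p0\<bar> < 1" using S2_inner_gt_m1[OF S] lt c by simp
  have "\<forall>\<^sub>F t in at_right 0. (\<forall>x\<in>X. c < x \<bullet> sgn (p0 + t *\<^sub>R - y)) \<and>
      0 < side (sgn (p0 + t *\<^sub>R - y)) \<and> p0 + t *\<^sub>R - y \<noteq> 0"
    unfolding side_def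
    by (intro eventually_conj eventually_perturb_bound eventually_perturb_nonzero S X
        finite_imp_compact fin strict order_tendstoD(1)[OF inner_sgn_perturb_tendsto[OF S(2)]])
      (use sp in \<open>simp_all add: side_def\<close>)
  then obtain t where t: "t > 0" "\<And>x. x \<in> X \<Longrightarrow> c < x \<bullet> sgn (p0 + t *\<^sub>R - y)"
      "0 < side (sgn (p0 + t *\<^sub>R - y))" "p0 + t *\<^sub>R - y \<noteq> 0"
    by (rule ex_eventually_at_right_0) auto
  then have "sgn (p0 - t *\<^sub>R y) \<in> L" using sgn_in_S2[OF t(4)] by (force simp: L_def caps_def)
  then show False using p0(2) move_away_decreases_inner[OF S abs t(1)] by fastforce
qed

text \<open>From \<open>G \<subseteq> caps c G\<close>, antitonicity gives one inclusion of
  self-duality; the other is the pairwise bound \<open>pair\<close>. Points on the same side of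
  \<open>ab\<close> are covered by the half lens, points on opposite sides by the vertices that were
  added.\<close>

lemma reuleaux_completion:
  obtains G where "finite G" "X \<subseteq> G" "G \<subseteq> caps c G" "self_dual c (caps c G)"
proof -
  define G where "G = X \<union> vertices"
  have pair: "c \<le> y \<bullet> y'" if "y \<in> caps c G" "y' \<in> caps c G" for y y'
  proof -
    have y: "y \<in> caps c X" "\<And>v. v \<in> vertices \<Longrightarrow> c \<le> y \<bullet> v"
      and y': "y' \<in> caps c X" "\<And>v. v \<in> vertices \<Longrightarrow> c \<le> y' \<bullet> v"
      using that by (auto simp: G_def caps_def inner_commute)
    consider "0 \<le> side y" "0 \<le> side y'" | "side y \<le> 0" "side y' \<le> 0"
      | "side y \<le> 0" "0 \<le> side y'" | "0 \<le> side y" "side y' \<le> 0" by linarith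
    then show ?thesis
    proof cases
      case 1
      then show ?thesis using same_side_ge y y' by blast
    next
      case 2
      then show ?thesis using other_side_ge y y' by blast
    next
      case 3
      then show ?thesis using opposite_side_ge[OF y y'(1)] by blast
    next
      case 4
      then show ?thesis using opposite_side_ge[OF y' y(1)] by (simp add: inner_commute)
    qed
  qed
  have vS: "vertices \<subseteq> caps c X" by (auto simp: vertices_def)
  have G: "G \<subseteq> caps c G"
  proof
    fix v assume v: "v \<in> G"
    then have vX: "v \<in> caps c X" using vS diam by (auto simp: G_def)
    have "c \<le> x \<bullet> v" if "x \<in> G" for x
    proof (cases "x \<in> X")
      case True
      then show ?thesis using vX capsD by blast
    next
      case False
      then have x: "x \<in> vertices" using that by (simp add: G_def)
      show ?thesis
      proof (cases "v \<in> X")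
        case True
        then show ?thesis using x vS capsD by (metis inner_commute subsetD)
      next
        case False
        then have "v \<in> vertices" using v by (simp add: G_def)
        then show ?thesis using same_side_ge[of x v] x by (simp add: vertices_def)
      qed
    qed
    then show "v \<in> caps c G" using caps_in_S2[OF vX] by (simp add: caps_def)
  qed
  have "caps c (caps c G) = caps c G"
    using caps_antimono[OF G] pair caps_subset_S2[of c G] by (fastforce simp: caps_def[of c "caps c G"])
  moreover have "a \<noteq> b" using ab c S2_inner_self[OF ab_S2(1)] by auto
  moreover have "a \<in> caps c G" "b \<in> caps c G" using G ab by (auto simp: G_def)
  ultimately have "self_dual c (caps c G)" using c by unfold_locales auto
  then show ?thesis using that[of G] G fin finite_vertices by (simp add: G_def)
qed

end

subsection \<open>The boundary of the polar of a Reuleaux polygon\<close>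

locale reuleaux_polygon = self_dual c "caps c G" for c :: real and G :: "point set" +
  assumes finite_G: "finite G" and G_sub: "G \<subseteq> caps c G"
    and two_centres: "\<exists>g\<in>G. \<exists>h\<in>G. g \<noteq> h"
begin

definition corners :: "point set" where
  "corners = {x \<in> caps c G. \<exists>g\<in>G. \<exists>h\<in>G. g \<noteq> h \<and> g \<bullet> x = c \<and> h \<bullet> x = c}"

definition normals :: "point \<Rightarrow> point set" where
  "normals x = {y \<in> caps 0 (caps c G). x \<bullet> y = 0}"

text \<open>The vector is the unit normal at the edge point
  \<open>c *\<^sub>R g + sqrt (1 - c\<^sup>2) *\<^sub>R u\<close>, pointing towards the centre
  \<open>g\<close>. Its distance from \<open>g\<close> is \<open>pi / 2 - arccos c\<close> for every
  \<open>u\<close>, so a dual edge is again an arc of a circle about \<open>g\<close>.\<close>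

definition boundary_arc :: "point \<Rightarrow> point set" where
  "boundary_arc g = (\<lambda>u. sqrt (1 - c\<^sup>2) *\<^sub>R g - c *\<^sub>R u) ` directions c G g"

lemma sin_pos: "sqrt (1 - c\<^sup>2) > 0"
  using c_pos c_less_1 by (simp add: power_less_one_iff)

lemma sin_sq: "(sqrt (1 - c\<^sup>2))\<^sup>2 = 1 - c\<^sup>2"
  using c_pos c_less_1 by (simp add: power_le_one)

lemma G_S2: "G \<subseteq> S2"
  using G_sub caps_subset_S2 by blast

lemma other_centre: "\<exists>h\<in>G. h \<noteq> g"
  using two_centres by metis

lemma finite_corners: "finite corners"
proof -
  have "corners \<subseteq> (\<Union>g\<in>G. \<Union>h\<in>G - {g}. {v \<in> S2. g \<bullet> v = c \<and> h \<bullet> v = c})"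
    by (auto simp: corners_def caps_def)
  moreover have "finite \<dots>"
  proof (intro finite_UN_I finite_Diff finite_circles_Int finite_G)
    fix g h assume gh: "g \<in> G" "h \<in> G - {g}"
    then show "g \<in> S2" "h \<in> S2" using G_S2 by auto
    then have "g \<bullet> h < 1" using gh by (intro S2_inner_less_1) auto
    moreover have "c \<le> g \<bullet> h" using gh G_sub capsD[of h c G g] by blast
    ultimately show "\<bar>g \<bullet> h\<bar> < 1" using c_pos by simp
  qed
  ultimately show ?thesis by (rule finite_subset)
qed

text \<open>For the edge point \<open>x\<close>, the vector \<open>g - c *\<^sub>R x\<close> of
  \<open>polar_of_member\<close> is \<open>sqrt (1 - c\<^sup>2)\<close> times the vector in
  question. Here \<open>u\<close> runs through the full circle of directions at
  \<open>g\<close>.\<close>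

lemma dual_circle_point:
  assumes g: "g \<in> G" and u: "u \<in> S2" "g \<bullet> u = 0"
  shows "sqrt (1 - c\<^sup>2) *\<^sub>R g - c *\<^sub>R u \<in> caps 0 (caps c G)" (is "?y \<in> _")
    and "g \<bullet> (sqrt (1 - c\<^sup>2) *\<^sub>R g - c *\<^sub>R u) = sqrt (1 - c\<^sup>2)"
    and "(c *\<^sub>R g + sqrt (1 - c\<^sup>2) *\<^sub>R u) \<bullet> (sqrt (1 - c\<^sup>2) *\<^sub>R g - c *\<^sub>R u) = 0"
proof -
  define s where "s = sqrt (1 - c\<^sup>2)"
  have s: "s > 0" "s\<^sup>2 = 1 - c\<^sup>2" using sin_pos sin_sq by (auto simp: s_def)
  have gS: "g \<in> S2" using g G_S2 by blast
  define x where "x = c *\<^sub>R g + s *\<^sub>R u"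
  have "x \<in> S2" unfolding x_def using circle_point_in_S2[OF gS u] s by simp
  then have D: "sgn (g - c *\<^sub>R x) \<in> caps 0 (caps c G)" using polar_of_member(2) g G_sub by blast
  have "g - c *\<^sub>R x = (1 - c\<^sup>2) *\<^sub>R g - (c * s) *\<^sub>R u"
    by (simp add: x_def algebra_simps power2_eq_square)
  also have "\<dots> = s *\<^sub>R (s *\<^sub>R g - c *\<^sub>R u)"
    unfolding s(2)[symmetric] by (simp add: algebra_simps power2_eq_square)
  finally have "sgn (g - c *\<^sub>R x) = sgn (s *\<^sub>R g - c *\<^sub>R u)"
    using s(1) by (simp add: sgn_scaleR)
  moreover have "s *\<^sub>R g - c *\<^sub>R u \<in> S2"
    using circle_point_in_S2[OF gS u, of s "- c"] s by simp
  ultimately show "?y \<in> caps 0 (caps c G)" using D sgn_S2 by (simp add: s_def)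
  have I: "g \<bullet> g = 1" "u \<bullet> u = 1" "u \<bullet> g = 0" using S2_inner_self gS u by (auto simp: inner_commute)
  show "g \<bullet> (sqrt (1 - c\<^sup>2) *\<^sub>R g - c *\<^sub>R u) = sqrt (1 - c\<^sup>2)"
    using I u by (simp add: inner_diff_right)
  show "(c *\<^sub>R g + sqrt (1 - c\<^sup>2) *\<^sub>R u) \<bullet> (sqrt (1 - c\<^sup>2) *\<^sub>R g - c *\<^sub>R u) = 0"
    using I u by (simp add: inner_diff_right inner_add_left)
qed

lemma boundary_arc_subset:
  assumes "g \<in> G"
  shows "boundary_arc g \<subseteq> sphere_boundary (caps 0 (caps c G))"
proof
  fix y assume "y \<in> boundary_arc g"
  then obtain u where y: "y = sqrt (1 - c\<^sup>2) *\<^sub>R g - c *\<^sub>R u"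
    and u: "u \<in> S2" "g \<bullet> u = 0" "c *\<^sub>R g + sqrt (1 - c\<^sup>2) *\<^sub>R u \<in> caps c G"
    by (auto simp: boundary_arc_def directions_def)
  show "y \<in> sphere_boundary (caps 0 (caps c G))"
    unfolding sphere_boundary_caps_0[OF compact_K K_S2]
    using dual_circle_point[OF assms u(1,2)] u(3) y by blast
qed

lemma circle_arc_boundary_arc:
  assumes g: "g \<in> G" and PQ: "directions c G g = great_arc P Q"
    "P \<in> directions c G g" "Q \<in> directions c G g" "P \<noteq> Q"
  shows "circle_arc (arccos (sqrt (1 - c\<^sup>2))) (boundary_arc g)"
proof -
  have gS: "g \<in> S2" using g G_S2 by blast
  obtain h where h: "h \<in> G" "h \<noteq> g" using other_centre by blast
  have "0 < h \<bullet> P" "0 < h \<bullet> Q"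
    using directions_inner_pos[OF G_S2 c_pos c_less_1 gS h] PQ by auto
  then have "P \<noteq> - Q" by auto
  moreover have "P \<in> S2" "Q \<in> S2" using PQ(2,3) by (auto simp: directions_def)
  ultimately obtain \<gamma> where \<gamma>: "arc \<gamma>" "path_image \<gamma> = directions c G g"
    using great_arc_path PQ(1,4) by metis
  define f where "f u = sqrt (1 - c\<^sup>2) *\<^sub>R g - c *\<^sub>R u" for u
  have "path (f \<circ> \<gamma>)" using \<gamma>(1) unfolding f_def
    by (intro path_continuous_image continuous_intros) (auto simp: arc_def)
  moreover have "inj f" using c_pos by (auto simp: f_def inj_def)
  then have "inj_on (f \<circ> \<gamma>) {0..1}" using \<gamma>(1)
    by (intro comp_inj_on) (auto simp: arc_def inj_on_def inj_def)
  ultimately have "arc (f \<circ> \<gamma>)" by (simp add: arc_def)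
  moreover have "path_image (f \<circ> \<gamma>) = boundary_arc g"
    using \<gamma>(2) by (simp add: path_image_compose boundary_arc_def f_def)
  moreover have "boundary_arc g \<subseteq> spherical_circle g (arccos (sqrt (1 - c\<^sup>2)))"
  proof
    fix y assume "y \<in> boundary_arc g"
    then obtain u where y: "y = sqrt (1 - c\<^sup>2) *\<^sub>R g - c *\<^sub>R u" and u: "u \<in> S2" "g \<bullet> u = 0"
      by (auto simp: boundary_arc_def directions_def)
    show "y \<in> spherical_circle g (arccos (sqrt (1 - c\<^sup>2)))"
      using dual_circle_point[OF g u] caps_in_S2 y by (simp add: spherical_circle_def sdist_def)
  qed
  ultimately show ?thesis unfolding circle_arc_def using gS by blast
qed

text \<open>Two centres \<open>g\<close> and \<open>h\<close> active at \<open>x\<close> yield the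
  normals along \<open>g - c *\<^sub>R x\<close> and \<open>h - c *\<^sub>R x\<close>; these vectors
  differ and have equal length, so the normals differ too. The arc of all normals is therefore
  nondegenerate.\<close>

lemma great_circle_segment_normals:
  assumes x: "x \<in> corners"
  shows "great_circle_segment (normals x)"
proof -
  obtain g h where gh: "g \<in> G" "h \<in> G" "g \<noteq> h" "g \<bullet> x = c" "h \<bullet> x = c"
    and xK: "x \<in> caps c G"
    using x by (auto simp: corners_def)
  have xS: "x \<in> S2" using xK caps_in_S2 by blast
  obtain z where z: "\<And>y. y \<in> caps 0 (caps c G) \<Longrightarrow> z \<bullet> y > 0" using ex_polar_pos by blast
  have mem: "sgn (k - c *\<^sub>R x) \<in> normals x" and nk: "norm (k - c *\<^sub>R x) = sqrt (1 - c\<^sup>2)"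
    if "k \<in> G" "k \<bullet> x = c" for k
  proof -
    have kS: "k \<in> S2" using that G_S2 by blast
    have I: "k \<bullet> k = 1" "x \<bullet> x = 1" "x \<bullet> k = c" using S2_inner_self kS xS that by (auto simp: inner_commute)
    show "sgn (k - c *\<^sub>R x) \<in> normals x"
      using polar_of_member(2)[OF _ xS] that G_sub I by (auto simp: normals_def inner_sgn_right inner_diff_right)
    show "norm (k - c *\<^sub>R x) = sqrt (1 - c\<^sup>2)"
      unfolding norm_eq_sqrt_inner using I that
      by (simp add: inner_diff_left inner_diff_right power2_eq_square)
  qed
  have ne: "sgn (g - c *\<^sub>R x) \<noteq> sgn (h - c *\<^sub>R x)"
  proof
    assume "sgn (g - c *\<^sub>R x) = sgn (h - c *\<^sub>R x)"
    then have "norm (g - c *\<^sub>R x) *\<^sub>R sgn (g - c *\<^sub>R x) = norm (h - c *\<^sub>R x) *\<^sub>R sgn (h - c *\<^sub>R x)"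
      using nk gh by simp
    then show False unfolding norm_scaleR_sgn using gh(3) by simp
  qed
  obtain P Q where PQ: "P \<in> normals x" "Q \<in> normals x" "normals x = great_arc P Q"
  proof (rule circle_convex_eq_great_arc[of "normals x" x z])
    have "normals x = caps 0 (caps c G) \<inter> {y. x \<bullet> y = 0}" by (auto simp: normals_def)
    moreover have "closed \<dots>"
      by (intro closed_Int closed_caps closed_Collect_eq continuous_intros)
    ultimately show "closed (normals x)" by simp
    show "normals x \<noteq> {}" using mem gh by blast
    show "normals x \<subseteq> S2" using caps_subset_S2 by (auto simp: normals_def)
    show "x \<noteq> 0" using xS by auto
    show "x \<bullet> u = 0" if "u \<in> normals x" for u using that by (simp add: normals_def)
    show "z \<bullet> u > 0" if "u \<in> normals x" for u using that z by (simp add: normals_def)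
    show "great_arc u v \<subseteq> normals x" if uv: "u \<in> normals x" "v \<in> normals x" for u v
    proof
      fix y assume y: "y \<in> great_arc u v"
      then obtain \<alpha> \<beta> where "y = \<alpha> *\<^sub>R u + \<beta> *\<^sub>R v" by (rule great_arc_cone)
      then have "x \<bullet> y = 0" using uv by (simp add: normals_def inner_add_right)
      moreover have "y \<in> caps 0 (caps c G)"
        using caps_great_arc[of 0 u "caps c G" v z] uv z y by (auto simp: normals_def)
      ultimately show "y \<in> normals x" by (simp add: normals_def)
    qed
  qed
  have S: "P \<in> S2" "Q \<in> S2" using PQ caps_in_S2 unfolding normals_def by blast+
  have "P \<noteq> Q"
  proof
    assume "P = Q"
    then have "normals x = {sgn P}" using PQ(3) by (simp add: great_arc_def)
    then show False using ne mem gh by (metis singletonD)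
  qed
  moreover have "P \<noteq> - Q" using z[of P] z[of Q] PQ(1,2) by (auto simp: normals_def)
  ultimately show ?thesis unfolding great_circle_segment_def using S PQ(3) by blast
qed

lemma some_active:
  assumes y: "y \<in> caps 0 (caps c G)" and x: "x \<in> caps c G" "x \<bullet> y = 0"
  obtains g where "g \<in> G" "g \<bullet> x = c"
proof (rule ccontr)
  assume "\<not> thesis"
  then have "\<And>g. g \<in> G \<Longrightarrow> g \<bullet> x \<noteq> c" using that by blast
  then have strict: "\<And>g. g \<in> G \<Longrightarrow> c < g \<bullet> x" using capsD[OF x(1)] by force
  have xS: "x \<in> S2" using x caps_in_S2 by blast
  have "\<forall>\<^sub>F t in at_right 0. (\<forall>g\<in>G. c < g \<bullet> sgn (x + t *\<^sub>R - y)) \<and> x + t *\<^sub>R - y \<noteq> 0"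
    by (intro eventually_conj eventually_perturb_bound eventually_perturb_nonzero xS G_S2
        finite_imp_compact finite_G strict)
  then obtain t where t: "t > 0" "\<And>g. g \<in> G \<Longrightarrow> c < g \<bullet> sgn (x + t *\<^sub>R - y)" "x + t *\<^sub>R - y \<noteq> 0"
    by (rule ex_eventually_at_right_0) auto
  then have "sgn (x + t *\<^sub>R - y) \<in> caps c G"
    using sgn_in_S2[OF t(3)] by (force simp: caps_def)
  then have "0 \<le> sgn (x + t *\<^sub>R - y) \<bullet> y" by (rule capsD[OF y])
  then have "0 \<le> y \<bullet> sgn (x + t *\<^sub>R - y)" by (simp only: inner_commute)
  moreover have "y \<bullet> (x + t *\<^sub>R - y) < 0"
    using x(2) S2_inner_self[OF caps_in_S2[OF y]] t by (simp add: inner_diff_right inner_commute)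
  ultimately show False using t(3) by (simp add: inner_sgn_right zero_le_divide_iff)
qed

text \<open>A second normal \<open>y\<close> would be violated by moving from the boundary point in the direction
  \<open>y1 - y\<close>, where \<open>y1\<close> is the normal pointing to the centre \<open>g\<close>.\<close>

lemma unique_normal:
  assumes y: "y \<in> caps 0 (caps c G)" and g: "g \<in> G" and u: "u \<in> directions c G g"
    and xy: "(c *\<^sub>R g + sqrt (1 - c\<^sup>2) *\<^sub>R u) \<bullet> y = 0"
    and only: "\<And>h. h \<in> G \<Longrightarrow> h \<noteq> g \<Longrightarrow> h \<bullet> (c *\<^sub>R g + sqrt (1 - c\<^sup>2) *\<^sub>R u) \<noteq> c"
  shows "y = sqrt (1 - c\<^sup>2) *\<^sub>R g - c *\<^sub>R u"
proof (rule ccontr)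
  define s where "s = sqrt (1 - c\<^sup>2)"
  have s: "s > 0" "s\<^sup>2 = 1 - c\<^sup>2" using sin_pos sin_sq by (auto simp: s_def)
  define x where "x = c *\<^sub>R g + s *\<^sub>R u"
  define y1 where "y1 = s *\<^sub>R g - c *\<^sub>R u"
  define v where "v = y1 - y"
  define \<kappa> where "\<kappa> = 1 - y1 \<bullet> y"
  assume "y \<noteq> sqrt (1 - c\<^sup>2) *\<^sub>R g - c *\<^sub>R u"
  then have neq: "y \<noteq> y1" by (simp add: y1_def s_def)
  have uS: "u \<in> S2" "g \<bullet> u = 0" and xK: "x \<in> caps c G"
    using u by (auto simp: directions_def x_def s_def)
  have y1: "y1 \<in> caps 0 (caps c G)" "x \<bullet> y1 = 0"
    using dual_circle_point[OF g uS] by (auto simp: x_def y1_def s_def)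
  have S: "x \<in> S2" "y \<in> S2" "y1 \<in> S2" using xK y y1 caps_in_S2 by auto
  have \<kappa>: "\<kappa> > 0" using S2_inner_less_1[OF S(3,2)] neq by (simp add: \<kappa>_def)
  have vy: "v \<bullet> y = - \<kappa>" using S2_inner_self[OF S(2)] by (simp add: v_def \<kappa>_def inner_diff_left)
  have xy0: "x \<bullet> y = 0" using xy by (simp add: x_def s_def)
  have xv: "x \<bullet> v = 0" using y1(2) xy0 by (simp add: v_def inner_diff_right)
  have vv: "v \<bullet> v = 2 * \<kappa>" using S2_norm_diff_sq[OF S(3,2)]
    by (simp add: v_def \<kappa>_def power2_norm_eq_inner)
  have "s *\<^sub>R y1 + c *\<^sub>R x = (s\<^sup>2 + c\<^sup>2) *\<^sub>R g"
    by (simp add: x_def y1_def algebra_simps power2_eq_square)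
  then have gexp: "g = s *\<^sub>R y1 + c *\<^sub>R x" using s by simp
  have "y1 \<bullet> v = \<kappa>" using S2_inner_self[OF S(3)] by (simp add: v_def \<kappa>_def inner_diff_right)
  then have gv: "g \<bullet> v = s * \<kappa>" unfolding gexp using xv by (simp add: inner_add_left)
  have gx: "g \<bullet> x = c" unfolding gexp using y1(2) S2_inner_self[OF S(1)]
    by (simp add: inner_add_left inner_commute[of y1 x])
  have "\<forall>\<^sub>F t in at_right 0. \<forall>h\<in>G - {g}. c < h \<bullet> sgn (x + t *\<^sub>R v)"
  proof (intro eventually_perturb_bound finite_imp_compact finite_Diff finite_G S)
    show "G - {g} \<subseteq> S2" using G_S2 by blast
    show "c < h \<bullet> x" if "h \<in> G - {g}" for h
      using only[of h] that capsD[OF xK, of h] by (simp add: x_def s_def)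
  qed
  \<comment> \<open>Below \<open>s / c\<close>, the first-order gain
    \<open>t * (s * \<kappa>)\<close> in the inner product with \<open>g\<close> outweighs the
    second-order loss \<open>c * \<kappa> * t\<^sup>2\<close> from normalisation.\<close>
  moreover have "\<forall>\<^sub>F t in at_right 0. t \<in> {0<..<s / c}"
    using s(1) c_pos by (intro eventually_at_right_real) simp
  ultimately have "\<forall>\<^sub>F t in at_right 0. (\<forall>h\<in>G - {g}. c < h \<bullet> sgn (x + t *\<^sub>R v))
      \<and> t \<in> {0<..<s / c} \<and> x + t *\<^sub>R v \<noteq> 0"
    by (intro eventually_conj eventually_perturb_nonzero S)
  then obtain t where t: "\<And>h. h \<in> G - {g} \<Longrightarrow> c < h \<bullet> sgn (x + t *\<^sub>R v)"
      "0 < t" "t < s / c" "x + t *\<^sub>R v \<noteq> 0"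
    by (rule ex_eventually_at_right_0) auto
  have "c \<le> g \<bullet> sgn (x + t *\<^sub>R v)"
  proof -
    have "(norm (x + t *\<^sub>R v))\<^sup>2 = 1 + 2 * (\<kappa> * t\<^sup>2)"
      unfolding power2_norm_eq_inner using xv vv S2_inner_self[OF S(1)]
      by (simp add: inner_add_left inner_add_right inner_commute[of v x] power2_eq_square)
    also have "\<dots> \<le> (1 + \<kappa> * t\<^sup>2)\<^sup>2"
      using zero_le_power2[of "\<kappa> * t\<^sup>2"] unfolding power2_sum[of 1] by simp
    finally have "norm (x + t *\<^sub>R v) \<le> 1 + \<kappa> * t\<^sup>2"
      by (rule power2_le_imp_le) (use \<kappa> in simp)
    then have "c * norm (x + t *\<^sub>R v) \<le> c * (1 + \<kappa> * t\<^sup>2)" using c_pos by simp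
    also have "\<dots> \<le> c + t * (s * \<kappa>)"
    proof -
      have "c * t \<le> s" using t(3) c_pos by (simp add: pos_less_divide_eq mult.commute)
      then have "(c * t) * (\<kappa> * t) \<le> s * (\<kappa> * t)" using \<kappa> t(2) by (intro mult_right_mono) auto
      then show ?thesis by (simp add: power2_eq_square algebra_simps)
    qed
    also have "\<dots> = g \<bullet> (x + t *\<^sub>R v)" using gv gx by (simp add: inner_add_right)
    finally show ?thesis using t(4) by (simp add: inner_sgn_right pos_le_divide_eq)
  qed
  then have "c \<le> h \<bullet> sgn (x + t *\<^sub>R v)" if "h \<in> G" for h
    using t(1)[of h] that by (cases "h = g") auto
  then have "sgn (x + t *\<^sub>R v) \<in> caps c G" using sgn_in_S2[OF t(4)] by (simp add: caps_def)
  then have "0 \<le> sgn (x + t *\<^sub>R v) \<bullet> y" by (rule capsD[OF y])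
  then have "0 \<le> y \<bullet> sgn (x + t *\<^sub>R v)" by (simp only: inner_commute)
  moreover have "y \<bullet> (x + t *\<^sub>R v) < 0"
    using xy0 vy \<kappa> t(2) by (simp add: inner_add_right inner_commute[of y])
  ultimately show False using t(4) by (simp add: inner_sgn_right zero_le_divide_iff)
qed

lemma boundary_consists_of_arcs_polar:
  "boundary_consists_of_arcs (arccos (sqrt (1 - c\<^sup>2))) (caps 0 (caps c G))"
proof -
  define \<rho> where "\<rho> = arccos (sqrt (1 - c\<^sup>2))"
  \<comment> \<open>The filter drops centres whose edge is empty or a single point, as these give no
    nondegenerate arc. A one-point edge is a corner, and its normals belong to the second
    family.\<close>
  define \<A> where "\<A> = {A \<in> boundary_arc ` G. circle_arc \<rho> A} \<union> normals ` corners"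
  have bd: "sphere_boundary (caps 0 (caps c G)) =
      {y \<in> caps 0 (caps c G). \<exists>x\<in>caps c G. x \<bullet> y = 0}"
    by (rule sphere_boundary_caps_0[OF compact_K K_S2])
  have "finite \<A>" unfolding \<A>_def using finite_G finite_corners by simp
  moreover have "\<forall>A\<in>\<A>. circle_arc \<rho> A \<or> great_circle_segment A"
    using great_circle_segment_normals by (auto simp: \<A>_def)
  moreover have "sphere_boundary (caps 0 (caps c G)) = \<Union>\<A>"
  proof
    have "normals x \<subseteq> sphere_boundary (caps 0 (caps c G))" if "x \<in> corners" for x
      using that unfolding bd normals_def corners_def by blast
    then show "\<Union>\<A> \<subseteq> sphere_boundary (caps 0 (caps c G))"
      using boundary_arc_subset unfolding \<A>_def by blast
    show "sphere_boundary (caps 0 (caps c G)) \<subseteq> \<Union>\<A>"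
    proof
      fix y assume "y \<in> sphere_boundary (caps 0 (caps c G))"
      then obtain x where y: "y \<in> caps 0 (caps c G)" and x: "x \<in> caps c G" "x \<bullet> y = 0"
        unfolding bd by blast
      show "y \<in> \<Union>\<A>"
      proof (cases "x \<in> corners")
        case True
        then show ?thesis using y x by (auto simp: \<A>_def normals_def)
      next
        case False
        obtain g where g: "g \<in> G" "g \<bullet> x = c" using some_active[OF y x] by blast
        have gS: "g \<in> S2" using g G_S2 by blast
        obtain u where u: "u \<in> S2" "g \<bullet> u = 0" "x = c *\<^sub>R g + sqrt (1 - c\<^sup>2) *\<^sub>R u"
          using circle_direction[OF gS caps_in_S2[OF x(1)] g(2) c_pos c_less_1] by blast
        have uD: "u \<in> directions c G g" using u x by (simp add: directions_def)
        have only: "\<And>h. h \<in> G \<Longrightarrow> h \<noteq> g \<Longrightarrow> h \<bullet> (c *\<^sub>R g + sqrt (1 - c\<^sup>2) *\<^sub>R u) \<noteq> c"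
          using False x(1) g unfolding u(3)[symmetric] by (auto simp: corners_def)
        have "y = sqrt (1 - c\<^sup>2) *\<^sub>R g - c *\<^sub>R u"
          using unique_normal[OF y g(1) uD _ only] x(2) u(3) by simp
        then have yA: "y \<in> boundary_arc g" using uD by (auto simp: boundary_arc_def)
        obtain h where h: "h \<in> G" "h \<noteq> g" using other_centre by blast
        obtain P Q where PQ: "P \<in> directions c G g" "Q \<in> directions c G g"
            "directions c G g = great_arc P Q"
          using directions_great_arc[OF G_S2 c_pos c_less_1 gS h] uD by blast
        have "P \<noteq> Q"
        proof
          assume "P = Q"
          then have "directions c G g = {sgn P}" using PQ(3) by (simp add: great_arc_def)
          then have "u = P" using uD PQ(1) by simp
          then show False
            using directions_endpoint_active[OF finite_G G_S2 c_pos c_less_1 gS PQ(3,1)] only by metis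
        qed
        then have "circle_arc \<rho> (boundary_arc g)"
          unfolding \<rho>_def using circle_arc_boundary_arc[OF g(1) PQ(3,1,2)] by blast
        then show ?thesis using yA g(1) by (auto simp: \<A>_def)
      qed
    qed
  qed
  ultimately show ?thesis unfolding boundary_consists_of_arcs_def \<rho>_def by blast
qed

end

subsection \<open>Approximation\<close>

text \<open>One \<open>t\<close> accounts for the displacement, the other for normalising a vector
  whose norm is within \<open>t\<close> of 1.\<close>

lemma sgn_perturb_dist:
  fixes y w :: point
  assumes "y \<in> S2" "w \<in> S2" "0 \<le> t" "t < 1"
  shows "y + t *\<^sub>R w \<noteq> 0" "dist (sgn (y + t *\<^sub>R w)) y \<le> 2 * t"
proof -
  define v where "v = y + t *\<^sub>R w"
  have d: "norm (v - y) = t" using assms by (simp add: v_def)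
  have n: "\<bar>norm v - 1\<bar> \<le> t" using norm_triangle_ineq3[of v y] d assms(1) by simp
  then show nz: "y + t *\<^sub>R w \<noteq> 0" using assms(4) by (auto simp: v_def)
  have "sgn v - v = (1 - norm v) *\<^sub>R sgn v" using norm_scaleR_sgn[of v] by (simp add: scaleR_diff_left)
  then have "norm (sgn v - v) = \<bar>1 - norm v\<bar>" using nz by (simp add: norm_sgn v_def)
  then have "norm (sgn v - v) \<le> t" using n by (simp add: abs_minus_commute)
  then show "dist (sgn (y + t *\<^sub>R w)) y \<le> 2 * t"
    using norm_triangle_ineq[of "sgn v - v" "v - y"] d by (simp add: dist_norm v_def)
qed

lemma sdist_le_of_dist:
  assumes "\<epsilon> > 0"
  obtains r where "r > 0" "\<And>P Q. P \<in> S2 \<Longrightarrow> Q \<in> S2 \<Longrightarrow> dist P Q \<le> r \<Longrightarrow> sdist P Q \<le> \<epsilon>"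
proof -
  \<comment> \<open>Truncation at \<open>pi\<close> keeps \<open>e\<close> where
    \<open>arccos\<close> inverts \<open>cos\<close>; \<open>r\<close> below is the chord length of
    the angle \<open>e\<close>.\<close>
  define e where "e = min \<epsilon> pi"
  have e: "0 < e" "e \<le> pi" "e \<le> \<epsilon>" using assms by (auto simp: e_def)
  define r where "r = sqrt (2 - 2 * cos e)"
  have "cos e < 1" using cos_monotone_0_pi[of 0 e] e by simp
  then have r: "r > 0" "r\<^sup>2 = 2 - 2 * cos e" by (simp_all add: r_def)
  have "sdist P Q \<le> \<epsilon>" if S: "P \<in> S2" "Q \<in> S2" and d: "dist P Q \<le> r" for P Q
  proof -
    have "(norm (P - Q))\<^sup>2 \<le> r\<^sup>2" using d by (intro power_mono) (auto simp: dist_norm)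
    then have "cos e \<le> P \<bullet> Q" using S2_norm_diff_sq[OF S] r(2) by simp
    then have "arccos (P \<bullet> Q) \<le> arccos (cos e)"
      using S2_inner_le_1[OF S] by (intro arccos_le_arccos) auto
    then show ?thesis using e by (simp add: arccos_cos sdist_def)
  qed
  then show ?thesis using that r(1) by blast
qed

lemma SUP_INF_sdist_le:
  assumes "X \<noteq> {}" "X \<subseteq> S2" "Y \<subseteq> S2" "\<And>P. P \<in> X \<Longrightarrow> \<exists>Q\<in>Y. sdist P Q \<le> \<epsilon>"
  shows "(SUP P\<in>X. INF Q\<in>Y. sdist P Q) \<le> \<epsilon>"
proof (rule cSUP_least[OF assms(1)])
  fix P assume P: "P \<in> X"
  then obtain Q where Q: "Q \<in> Y" "sdist P Q \<le> \<epsilon>" using assms(4) by blast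
  have "bdd_below (sdist P ` Y)"
  proof (rule bdd_belowI2)
    fix R assume "R \<in> Y"
    then have "\<bar>P \<bullet> R\<bar> \<le> 1" using S2_abs_inner_le_1 P assms by blast
    then show "0 \<le> sdist P R" by (simp add: sdist_def arccos_lbound abs_le_iff)
  qed
  then show "(INF Q\<in>Y. sdist P Q) \<le> \<epsilon>" using Q by (rule cINF_lower2)
qed

lemma hausdorff_sdist_le:
  assumes "X \<noteq> {}" "Y \<noteq> {}" "X \<subseteq> S2" "Y \<subseteq> S2"
    and "\<And>P. P \<in> X \<Longrightarrow> \<exists>Q\<in>Y. sdist P Q \<le> \<epsilon>" "\<And>Q. Q \<in> Y \<Longrightarrow> \<exists>P\<in>X. sdist Q P \<le> \<epsilon>"
  shows "hausdorff_sdist X Y \<le> \<epsilon>"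
proof -
  have "(SUP P\<in>X. INF Q\<in>Y. sdist P Q) \<le> \<epsilon>"
    using assms by (intro SUP_INF_sdist_le) auto
  moreover have "(SUP Q\<in>Y. INF P\<in>X. sdist Q P) \<le> \<epsilon>"
    using assms by (intro SUP_INF_sdist_le) auto
  ultimately show ?thesis unfolding hausdorff_sdist_def by (simp add: sdist_def inner_commute)
qed

text \<open>Inner products within \<open>K\<close> are at least \<open>c\<close>, so adding
  \<open>(\<delta> / c) *\<^sub>R a\<close> for some \<open>a\<close> in \<open>K\<close> raises
  every constraint by at least \<open>\<delta>\<close>.\<close>

lemma (in self_dual) near_polar:
  assumes P: "P \<in> S2" "\<And>x. x \<in> K \<Longrightarrow> - \<delta> \<le> x \<bullet> P" and \<delta>: "0 \<le> \<delta>" "\<delta> < c"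
  obtains Q where "Q \<in> caps 0 K" "dist Q P \<le> 2 * \<delta> / c"
proof -
  obtain a where a: "a \<in> K" using two_points by blast
  then have aS: "a \<in> S2" using K_S2 by blast
  have t: "0 \<le> \<delta> / c" "\<delta> / c < 1" using \<delta> c_pos by auto
  note n = sgn_perturb_dist[OF P(1) aS t]
  have "0 \<le> x \<bullet> (P + (\<delta> / c) *\<^sub>R a)" if x: "x \<in> K" for x
  proof -
    have "\<delta> / c * c \<le> \<delta> / c * (x \<bullet> a)" using K_ge[OF x a] t by (intro mult_left_mono) auto
    then have "\<delta> \<le> \<delta> / c * (x \<bullet> a)" using c_pos by simp
    then show ?thesis using P(2)[OF x] by (simp add: inner_add_right)
  qed
  then have "sgn (P + (\<delta> / c) *\<^sub>R a) \<in> caps 0 K"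
    using sgn_in_S2[OF n(1)] by (auto simp: caps_def inner_sgn_right)
  then show ?thesis using that n(2) by simp
qed

lemma inner_ge_of_dist:
  fixes P Q y :: point
  assumes "norm y = 1" "k \<le> y \<bullet> Q" "dist P Q \<le> \<delta>"
  shows "k - \<delta> \<le> y \<bullet> P"
proof -
  have "y \<bullet> Q - y \<bullet> P \<le> norm y * norm (Q - P)"
    using norm_cauchy_schwarz[of y "Q - P"] by (simp add: inner_diff_right)
  then show ?thesis using assms by (simp add: dist_norm norm_minus_commute)
qed

text \<open>If \<open>y\<close> almost lies in \<open>K\<close> and \<open>z\<close> is an interior point of \<open>K\<close>, then \<open>sgn (y + t z)\<close> lies in \<open>K\<close>
  already for small \<open>t\<close>. This is applied to \<open>K\<close> and to both polars.\<close>

lemma polar_stability: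
  assumes "self_dual c K" "r > 0"
  obtains \<eta> where "\<eta> > 0"
    "\<And>K' X. self_dual c K' \<Longrightarrow> X \<subseteq> K' \<Longrightarrow> (\<And>P. P \<in> K \<Longrightarrow> \<exists>x\<in>X. dist P x \<le> \<eta>) \<Longrightarrow>
      (\<forall>P\<in>caps 0 K. \<exists>Q\<in>caps 0 K'. dist P Q \<le> r) \<and> (\<forall>Q\<in>caps 0 K'. \<exists>P\<in>caps 0 K. dist Q P \<le> r)"
proof -
  interpret K: self_dual c K by fact
  obtain z c' where z: "z \<in> K" "c' > c" "\<And>x. x \<in> K \<Longrightarrow> c' \<le> z \<bullet> x" using K.centre by blast
  have zS: "z \<in> S2" using z K.K_S2 by blast
  have c'1: "c' \<le> 1" using z(3)[OF z(1)] S2_inner_self[OF zS] by simp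
  define m where "m = min r 1"
  have m: "0 < m" "m \<le> 1" "m \<le> r" using assms(2) by (auto simp: m_def)
  \<comment> \<open>\<open>t\<close> makes the final bound \<open>2 * (2 * t) / c\<close> equal to
    \<open>m \<le> r\<close>, and \<open>m \<le> 1\<close> ensures \<open>2 * t < c\<close>.
    \<open>\<eta>\<close> is exactly the error that the slack at \<open>z\<close> pays for:
    \<open>c - \<eta> + t * c' = c * (1 + t)\<close>.\<close>
  define t where "t = c * m / 4"
  define \<eta> where "\<eta> = (c' - c) * t"
  have t: "0 < t" "2 * t < c" "t < 1" "2 * (2 * t) / c = m"
    using m K.c_pos K.c_less_1 mult_left_le[of m c] mult_le_one[of c m] by (auto simp: t_def)
  have \<eta>: "0 < \<eta>" "\<eta> \<le> t" using z(2) t(1) c'1 K.c_pos mult_right_mono[of "c' - c" 1 t] by (auto simp: \<eta>_def)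
  have tr: "2 * (2 * t) / c \<le> r" using t(4) m(3) by simp
  have main: "(\<forall>P\<in>caps 0 K. \<exists>Q\<in>caps 0 K'. dist P Q \<le> r) \<and> (\<forall>Q\<in>caps 0 K'. \<exists>P\<in>caps 0 K. dist Q P \<le> r)"
    if "self_dual c K'" and X: "X \<subseteq> K'" and net: "\<And>P. P \<in> K \<Longrightarrow> \<exists>x\<in>X. dist P x \<le> \<eta>" for K' X
  proof -
    interpret K': self_dual c K' by fact
    \<comment> \<open>The net transfers the constraints: \<open>y\<close> is within
      \<open>arccos c\<close> of \<open>X\<close>, hence satisfies the constraints of all of
      \<open>K\<close> up to \<open>\<eta>\<close>.\<close>
    have close: "\<exists>y'\<in>K. dist y y' \<le> 2 * t" if y: "y \<in> K'" for y
    proof -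
      have yS: "y \<in> S2" using y K'.K_S2 by blast
      note n = sgn_perturb_dist[OF yS zS less_imp_le[OF t(1)] t(3)]
      have "c \<le> P \<bullet> sgn (y + t *\<^sub>R z)" if P: "P \<in> K" for P
      proof -
        obtain x where x: "x \<in> X" "dist P x \<le> \<eta>" using net P by blast
        have "c - \<eta> \<le> y \<bullet> P" using inner_ge_of_dist[of y c x P \<eta>] x K'.K_ge[OF y, of x] X yS by auto
        moreover have "t * c' \<le> t * (z \<bullet> P)" using z(3)[OF P] t(1) by simp
        ultimately have ge: "c - \<eta> + t * c' \<le> P \<bullet> (y + t *\<^sub>R z)"
          by (simp add: inner_add_right inner_commute)
        have "norm (y + t *\<^sub>R z) \<le> 1 + t"
          using norm_triangle_ineq[of y "t *\<^sub>R z"] t(1) yS zS by simp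
        then have "c * norm (y + t *\<^sub>R z) \<le> c * (1 + t)" using K.c_pos by simp
        also have "\<dots> = c - \<eta> + t * c'" by (simp add: \<eta>_def algebra_simps)
        finally have "c * norm (y + t *\<^sub>R z) \<le> P \<bullet> (y + t *\<^sub>R z)" using ge by simp
        then show ?thesis using n(1) by (simp add: inner_sgn_right pos_le_divide_eq)
      qed
      then have "sgn (y + t *\<^sub>R z) \<in> caps c K" using sgn_in_S2[OF n(1)] by (simp add: caps_def)
      then show ?thesis using n(2) K.dual by (metis dist_commute)
    qed
    have "\<exists>Q\<in>caps 0 K'. dist P Q \<le> r" if P: "P \<in> caps 0 K" for P
    proof -
      have PS: "P \<in> S2" using P caps_in_S2 by blast
      have "- (2 * t) \<le> y \<bullet> P" if yK': "y \<in> K'" for y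
      proof -
        obtain y' where y': "y' \<in> K" "dist y y' \<le> 2 * t" using close yK' by blast
        have "0 \<le> P \<bullet> y'" using capsD[OF P y'(1)] by (simp add: inner_commute)
        then have "0 - 2 * t \<le> P \<bullet> y"
          using PS y'(2) by (intro inner_ge_of_dist[of P 0 y' y]) auto
        then show ?thesis by (simp add: inner_commute)
      qed
      then obtain Q where "Q \<in> caps 0 K'" "dist Q P \<le> 2 * (2 * t) / c"
        using K'.near_polar[OF PS, of "2 * t"] t by force
      then show ?thesis using tr by (metis dist_commute order_trans)
    qed
    moreover have "\<exists>P\<in>caps 0 K. dist Q P \<le> r" if Q: "Q \<in> caps 0 K'" for Q
    proof -
      have QS: "Q \<in> S2" using Q caps_in_S2 by blast
      have "- \<eta> \<le> P \<bullet> Q" if PK: "P \<in> K" for P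
      proof -
        obtain x where x: "x \<in> X" "dist P x \<le> \<eta>" using net PK by blast
        have "0 \<le> Q \<bullet> x" using capsD[OF Q subsetD[OF X x(1)]] by (simp add: inner_commute)
        then have "0 - \<eta> \<le> Q \<bullet> P"
          using QS x(2) by (intro inner_ge_of_dist[of Q 0 x P]) auto
        then show ?thesis by (simp add: inner_commute)
      qed
      then obtain P where P: "P \<in> caps 0 K" "dist P Q \<le> 2 * \<eta> / c"
        using K.near_polar[OF QS, of \<eta>] \<eta> t by force
      have "2 * \<eta> / c \<le> 2 * (2 * t) / c" using \<eta> t(1) K.c_pos by (intro divide_right_mono) auto
      then show ?thesis using P tr by (metis dist_commute order_trans)
    qed
    ultimately show ?thesis by blast
  qed
  show ?thesis by (rule that[OF \<eta>(1)]) (rule main)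
qed

theorem theorem2:
  fixes \<tau> :: real and C :: "point set"
  assumes "\<tau> > pi / 2"
    and "spherical_convex_body C"
    and "constant_width C \<tau>"
  shows "\<forall>\<epsilon>>0. \<exists>D. spherical_convex_body D \<and> constant_width D \<tau> \<and>
           boundary_consists_of_arcs (\<tau> - pi / 2) D \<and> hausdorff_sdist C D \<le> \<epsilon>"
proof (intro allI impI)
  fix \<epsilon> :: real assume "\<epsilon> > 0"
  interpret C: spherical_body C by unfold_locales fact
  define c where "c = - cos \<tau>"
  define K where "K = caps 0 C"
  note polar = C.polar_self_dual[OF assms(1,3)]
  have tau: "\<tau> < pi" by (rule polar(1))
  interpret K: self_dual c K using polar(2) by (simp add: c_def K_def)
  obtain a b where ab: "a \<in> K" "b \<in> K" "a \<bullet> b = c" using polar(3) by (auto simp: c_def K_def)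
  obtain r where r: "r > 0" "\<And>P Q. P \<in> S2 \<Longrightarrow> Q \<in> S2 \<Longrightarrow> dist P Q \<le> r \<Longrightarrow> sdist P Q \<le> \<epsilon>"
    using sdist_le_of_dist[OF \<open>\<epsilon> > 0\<close>] by blast
  obtain \<eta> where \<eta>: "\<eta> > 0" and stable:
    "\<And>K' X. self_dual c K' \<Longrightarrow> X \<subseteq> K' \<Longrightarrow> (\<And>P. P \<in> K \<Longrightarrow> \<exists>x\<in>X. dist P x \<le> \<eta>) \<Longrightarrow>
      (\<forall>P\<in>caps 0 K. \<exists>Q\<in>caps 0 K'. dist P Q \<le> r) \<and> (\<forall>Q\<in>caps 0 K'. \<exists>P\<in>caps 0 K. dist Q P \<le> r)"
    using polar_stability[OF K.self_dual_axioms r(1)] by blast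
  obtain Y where Y: "Y \<subseteq> K" "finite Y" "K \<subseteq> (\<Union>x\<in>Y. ball x \<eta>)"
    using compactE_image[OF K.compact_K, of K "\<lambda>x. ball x \<eta>"] \<eta> by (metis UN_I centre_in_ball open_ball subsetI)
  define X where "X = insert a (insert b Y)"
  have XK: "X \<subseteq> K" using Y ab by (auto simp: X_def)
  interpret X: diametral_set c X a b
  proof
    show "X \<subseteq> S2" using XK K.K_S2 by blast
    show "X \<subseteq> caps c X" using XK K.dual caps_antimono by blast
  qed (use K.c_pos K.c_less_1 Y ab in \<open>auto simp: X_def\<close>)
  obtain G where G: "finite G" "X \<subseteq> G" "G \<subseteq> caps c G" "self_dual c (caps c G)"
    using X.reuleaux_completion by blast
  have "a \<noteq> b" using ab K.c_less_1 S2_inner_self[of a] K.K_S2 by auto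
  then have "\<exists>g\<in>G. \<exists>h\<in>G. g \<noteq> h" using G(2) by (auto simp: X_def)
  then interpret G: reuleaux_polygon c G
    using G by (simp add: reuleaux_polygon_def reuleaux_polygon_axioms_def)
  define D where "D = caps 0 (caps c G)"
  have "arccos c = pi - \<tau>"
    using arccos_cos[of "pi - \<tau>"] tau assms(1) by (simp add: c_def)
  then have "constant_width D \<tau>" using G.constant_width_polar by (simp add: D_def)
  moreover have "sqrt (1 - c\<^sup>2) = cos (\<tau> - pi / 2)"
  proof -
    have "sin \<tau> \<ge> 0" using tau assms(1) pi_gt_zero by (intro sin_ge_zero) linarith+
    then have "sqrt (1 - c\<^sup>2) = sin \<tau>" by (simp add: c_def flip: sin_squared_eq)
    then show ?thesis by (simp add: cos_diff)
  qed
  then have "arccos (sqrt (1 - c\<^sup>2)) = \<tau> - pi / 2"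
    using tau assms(1) by (simp add: arccos_cos)
  then have "boundary_consists_of_arcs (\<tau> - pi / 2) D"
    using G.boundary_consists_of_arcs_polar by (simp add: D_def)
  moreover have "hausdorff_sdist C D \<le> \<epsilon>"
  proof -
    have "\<exists>x\<in>X. dist P x \<le> \<eta>" if "P \<in> K" for P
      using Y(3) that by (fastforce simp: X_def dist_commute)
    \<comment> \<open>\<open>C.bipolar\<close> identifies \<open>caps 0 K\<close> with
      \<open>C\<close>, so the stability of polars compares \<open>C\<close> with
      \<open>D\<close>.\<close>
    then have near: "\<forall>P\<in>C. \<exists>Q\<in>D. dist P Q \<le> r" "\<forall>Q\<in>D. \<exists>P\<in>C. dist Q P \<le> r"
      using stable[OF G(4), of X] G(2,3) C.bipolar by (auto simp: D_def K_def)
    have D: "D \<subseteq> S2" unfolding D_def by (rule caps_subset_S2)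
    have "C \<noteq> {}" using C.interior_point by blast
    then have "D \<noteq> {}" using near by blast
    show ?thesis
      using near r(2) D C.C_S2 \<open>C \<noteq> {}\<close> \<open>D \<noteq> {}\<close> by (intro hausdorff_sdist_le) blast+
  qed
  ultimately show "\<exists>D. spherical_convex_body D \<and> constant_width D \<tau> \<and>
           boundary_consists_of_arcs (\<tau> - pi / 2) D \<and> hausdorff_sdist C D \<le> \<epsilon>"
    using G.spherical_convex_body_polar unfolding D_def by blast
qed

end
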